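(* Let $(Z,Z_{ac},e)$ be an accretive archimedean matrix-order unit space. Then there exist a Hilbert space $H$ and a real-complete order embedding $\phi:Z\to B(H)$ with $\phi(e)=I_H$. Moreover, $\phi$ is completely isometric with respect to the norms on $M_n(Z)$ given by $$\|z\|_n=\inf\left\{t>0:\ t\,e\otimes I_{2n}-\begin{bmatrix}0&2z\\0&0\end{bmatrix}\in Z_{ac}^{2n}\right\},$$ i.e. $\|\phi^{(n)}(z)\|_{B(H^n)}=\|z\|_n$ for all $n$ and $z\in M_n(Z)$.
   Context: For a complex vector space $Z$, $M_n(Z)$ denotes the $n\times n$ matrices over $Z$; for a scalar matrix $X\in M_{n,k}$ and $A\in M_n(Z)$, $X^*AX$ is defined by matrix multiplication. A cone is a set $C$ with $C+C\subseteq C$ and $tC\subseteq C$ for $t\ge0$. A matrix cone in $Z$ is a sequence of cones $C_n\subseteq M_n(Z)$ with $X^*C_nX\subseteq C_k$ for all $X\in M_{n,k}$. It is $\mathbb{C}$-proper if $C_1\cap -C_1\cap iC_1\cap -iC_1=\{0\}$; then $(Z,Z_{ac})$, $Z_{ac}=\{Z_{ac}^n\}$, is called an accretive matrix-ordered vector space, and one sets $Z_{sa}^n=iZ_{ac}^n\cap -iZ_{ac}^n$, $Z_+^n=Z_{sa}^n\cap Z_{ac}^n$. For $e\in Z$, $e\otimes I_n$ is the diagonal matrix in $M_n(Z)$ with all diagonal entries $e$. An element $e\in Z_{sa}^1$ is an accretive matrix-order unit if for every $n$ and $z\in M_n(Z)$ there is $t>0$ with $te\otimes I_n+z\in Z_{ac}^n$;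 it is archimedean if $te\otimes I_n+z\in Z_{ac}^n$ for all $t>0$ implies $z\in Z_{ac}^n$. Then $(Z,Z_{ac},e)$ is an accretive archimedean matrix-order unit space. For a Hilbert space $H$, $M_n(B(H))=B(H^n)$ carries the accretive cones $\{T:\operatorname{Re}(T)=\frac12(T+T^* )\ge0\}$. A linear map $\phi$ is real-completely positive if $\phi^{(n)}$ (entrywise application) maps $Z_{ac}^n$ into the target's accretive cone for all $n$; it is a real-complete order embedding if injective and both $\phi$ and $\phi^{-1}$ (on the range) are real-completely positive. *)

theory Defs
  imports "HOL-Analysis.Analysis" "HOL-Library.Function_Algebras"
begin

text \<open>Z is an abelian group 'z with a complex scalar multiplication sc such that
  vector_space sc holds. An n x n matrix over Z is a function nat => nat => 'z
  vanishing outside {0..<n} x {0..<n}.\<close>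

definition mats :: "nat \<Rightarrow> (nat \<Rightarrow> nat \<Rightarrow> 'z::zero) set" where
  "mats n = {A. \<forall>i j. (n \<le> i \<or> n \<le> j) \<longrightarrow> A i j = 0}"

definition mscale :: "(complex \<Rightarrow> 'z \<Rightarrow> 'z) \<Rightarrow> complex \<Rightarrow> (nat \<Rightarrow> nat \<Rightarrow> 'z) \<Rightarrow> (nat \<Rightarrow> nat \<Rightarrow> 'z)" where
  "mscale sc c A = (\<lambda>i j. sc c (A i j))"

text \<open>X^* A X for a scalar n x k matrix X and A in M_n(Z); the result is in M_k(Z).\<close>
definition congr :: "(complex \<Rightarrow> 'z \<Rightarrow> 'z::comm_monoid_add) \<Rightarrow> nat \<Rightarrow> nat
    \<Rightarrow> (nat \<Rightarrow> nat \<Rightarrow> complex) \<Rightarrow> (nat \<Rightarrow> nat \<Rightarrow> 'z) \<Rightarrow> (nat \<Rightarrow> nat \<Rightarrow> 'z)" where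
  "congr sc n k X A = (\<lambda>p q. if p < k \<and> q < k
      then (\<Sum>i<n. \<Sum>j<n. sc (cnj (X i p) * X j q) (A i j)) else 0)"

definition is_cone :: "(complex \<Rightarrow> 'z \<Rightarrow> 'z::ab_group_add) \<Rightarrow> (nat \<Rightarrow> nat \<Rightarrow> 'z) set \<Rightarrow> bool" where
  "is_cone sc K \<longleftrightarrow> (\<forall>A\<in>K. \<forall>B\<in>K. A + B \<in> K)
      \<and> (\<forall>A\<in>K. \<forall>t::real. t \<ge> 0 \<longrightarrow> mscale sc (complex_of_real t) A \<in> K)"

definition matrix_cone :: "(complex \<Rightarrow> 'z \<Rightarrow> 'z::ab_group_add) \<Rightarrow> (nat \<Rightarrow> (nat \<Rightarrow> nat \<Rightarrow> 'z) set) \<Rightarrow> bool" where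
  "matrix_cone sc C \<longleftrightarrow>
     (\<forall>n\<ge>1. C n \<subseteq> mats n \<and> is_cone sc (C n))
   \<and> (\<forall>n\<ge>1. \<forall>k\<ge>1. \<forall>X. \<forall>A\<in>C n. congr sc n k X A \<in> C k)"

definition C_proper :: "(complex \<Rightarrow> 'z \<Rightarrow> 'z::ab_group_add) \<Rightarrow> (nat \<Rightarrow> (nat \<Rightarrow> nat \<Rightarrow> 'z) set) \<Rightarrow> bool" where
  "C_proper sc C \<longleftrightarrow>
     C 1 \<inter> mscale sc (-1) ` C 1 \<inter> mscale sc \<i> ` C 1 \<inter> mscale sc (-\<i>) ` C 1 = {0}"

definition accretive_mos :: "(complex \<Rightarrow> 'z \<Rightarrow> 'z::ab_group_add) \<Rightarrow> (nat \<Rightarrow> (nat \<Rightarrow> nat \<Rightarrow> 'z) set) \<Rightarrow> bool" where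
  "accretive_mos sc C \<longleftrightarrow> vector_space sc \<and> matrix_cone sc C \<and> C_proper sc C"

definition Zsa :: "(complex \<Rightarrow> 'z \<Rightarrow> 'z::ab_group_add) \<Rightarrow> (nat \<Rightarrow> (nat \<Rightarrow> nat \<Rightarrow> 'z) set) \<Rightarrow> nat \<Rightarrow> (nat \<Rightarrow> nat \<Rightarrow> 'z) set" where
  "Zsa sc C n = mscale sc \<i> ` C n \<inter> mscale sc (-\<i>) ` C n"

definition sgl :: "'z::zero \<Rightarrow> (nat \<Rightarrow> nat \<Rightarrow> 'z)" where
  "sgl z = (\<lambda>i j. if i = 0 \<and> j = 0 then z else 0)"

definition diagI :: "'z::zero \<Rightarrow> nat \<Rightarrow> (nat \<Rightarrow> nat \<Rightarrow> 'z)" where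
  "diagI e n = (\<lambda>i j. if i = j \<and> i < n then e else 0)"

definition accretive_mou :: "(complex \<Rightarrow> 'z \<Rightarrow> 'z::ab_group_add) \<Rightarrow> (nat \<Rightarrow> (nat \<Rightarrow> nat \<Rightarrow> 'z) set) \<Rightarrow> 'z \<Rightarrow> bool" where
  "accretive_mou sc C e \<longleftrightarrow> sgl e \<in> Zsa sc C 1
     \<and> (\<forall>n\<ge>1. \<forall>z\<in>mats n. \<exists>t::real. t > 0
          \<and> mscale sc (complex_of_real t) (diagI e n) + z \<in> C n)"

definition archimedean_mou :: "(complex \<Rightarrow> 'z \<Rightarrow> 'z::ab_group_add) \<Rightarrow> (nat \<Rightarrow> (nat \<Rightarrow> nat \<Rightarrow> 'z) set) \<Rightarrow> 'z \<Rightarrow> bool" where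
  "archimedean_mou sc C e \<longleftrightarrow> accretive_mou sc C e
     \<and> (\<forall>n\<ge>1. \<forall>z\<in>mats n.
          (\<forall>t::real. t > 0 \<longrightarrow> mscale sc (complex_of_real t) (diagI e n) + z \<in> C n)
          \<longrightarrow> z \<in> C n)"

definition aamou_space :: "(complex \<Rightarrow> 'z \<Rightarrow> 'z::ab_group_add) \<Rightarrow> (nat \<Rightarrow> (nat \<Rightarrow> nat \<Rightarrow> 'z) set) \<Rightarrow> 'z \<Rightarrow> bool" where
  "aamou_space sc C e \<longleftrightarrow> accretive_mos sc C \<and> archimedean_mou sc C e"

definition corner2 :: "nat \<Rightarrow> (nat \<Rightarrow> nat \<Rightarrow> 'z::ab_group_add) \<Rightarrow> (nat \<Rightarrow> nat \<Rightarrow> 'z)" where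
  "corner2 n z = (\<lambda>p q. if p < n \<and> n \<le> q \<and> q < 2 * n then z p (q - n) + z p (q - n) else 0)"

definition mou_norm :: "(complex \<Rightarrow> 'z \<Rightarrow> 'z::ab_group_add) \<Rightarrow> (nat \<Rightarrow> (nat \<Rightarrow> nat \<Rightarrow> 'z) set) \<Rightarrow> 'z
     \<Rightarrow> nat \<Rightarrow> (nat \<Rightarrow> nat \<Rightarrow> 'z) \<Rightarrow> real" where
  "mou_norm sc C e n z = Inf {t::real. t > 0 \<and>
      mscale sc (complex_of_real t) (diagI e (2 * n)) - corner2 n z \<in> C (2 * n)}"

definition l2 :: "'i set \<Rightarrow> ('i \<Rightarrow> complex) set" where
  "l2 I = {f. (\<forall>x. x \<notin> I \<longrightarrow> f x = 0) \<and> (\<lambda>x. (cmod (f x))\<^sup>2) summable_on I}"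

definition l2_inner :: "'i set \<Rightarrow> ('i \<Rightarrow> complex) \<Rightarrow> ('i \<Rightarrow> complex) \<Rightarrow> complex" where
  "l2_inner I f g = infsum (\<lambda>x. f x * cnj (g x)) I"

definition l2_norm :: "'i set \<Rightarrow> ('i \<Rightarrow> complex) \<Rightarrow> real" where
  "l2_norm I f = sqrt (infsum (\<lambda>x. (cmod (f x))\<^sup>2) I)"

text \<open>B(l^2(I)): bounded linear operators; values outside l^2(I) are normalised to 0.\<close>
definition bops :: "'i set \<Rightarrow> (('i \<Rightarrow> complex) \<Rightarrow> ('i \<Rightarrow> complex)) set" where
  "bops I = {T. (\<forall>f\<in>l2 I. T f \<in> l2 I) \<and> (\<forall>f. f \<notin> l2 I \<longrightarrow> T f = 0)
     \<and> (\<forall>f\<in>l2 I. \<forall>g\<in>l2 I. \<forall>a b. T (\<lambda>x. a * f x + b * g x) = (\<lambda>x. a * T f x + b * T g x))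
     \<and> (\<exists>K. \<forall>f\<in>l2 I. l2_norm I (T f) \<le> K * l2_norm I f)}"

definition idop :: "'i set \<Rightarrow> (('i \<Rightarrow> complex) \<Rightarrow> ('i \<Rightarrow> complex))" where
  "idop I = (\<lambda>f. if f \<in> l2 I then f else 0)"

text \<open>M_n(B(H)) = B(H^n): an n x n matrix T of operators acts on xi \<in> H^n by
  (T xi)_i = sum_j T_ij xi_j; the inner product on H^n is the sum of the coordinate ones.\<close>
definition vecs :: "'i set \<Rightarrow> nat \<Rightarrow> (nat \<Rightarrow> ('i \<Rightarrow> complex)) set" where
  "vecs I n = {xi. \<forall>i<n. xi i \<in> l2 I}"

definition opmat_apply :: "nat \<Rightarrow> (nat \<Rightarrow> nat \<Rightarrow> (('i \<Rightarrow> complex) \<Rightarrow> ('i \<Rightarrow> complex)))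
     \<Rightarrow> (nat \<Rightarrow> ('i \<Rightarrow> complex)) \<Rightarrow> (nat \<Rightarrow> ('i \<Rightarrow> complex))" where
  "opmat_apply n T xi = (\<lambda>i. (\<lambda>x. \<Sum>j<n. T i j (xi j) x))"

definition vec_inner :: "'i set \<Rightarrow> nat \<Rightarrow> (nat \<Rightarrow> ('i \<Rightarrow> complex)) \<Rightarrow> (nat \<Rightarrow> ('i \<Rightarrow> complex)) \<Rightarrow> complex" where
  "vec_inner I n xi eta = (\<Sum>i<n. l2_inner I (xi i) (eta i))"

definition vec_norm :: "'i set \<Rightarrow> nat \<Rightarrow> (nat \<Rightarrow> ('i \<Rightarrow> complex)) \<Rightarrow> real" where
  "vec_norm I n xi = sqrt (\<Sum>i<n. (l2_norm I (xi i))\<^sup>2)"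

text \<open>Accretive cone of B(H^n): Re(T) = (T + T^*)/2 >= 0, i.e.
  <Re(T) xi, xi> = (<T xi, xi> + <xi, T xi>)/2 >= 0 for all xi.\<close>
definition opmat_accretive :: "'i set \<Rightarrow> nat \<Rightarrow> (nat \<Rightarrow> nat \<Rightarrow> (('i \<Rightarrow> complex) \<Rightarrow> ('i \<Rightarrow> complex))) \<Rightarrow> bool" where
  "opmat_accretive I n T \<longleftrightarrow> (\<forall>xi\<in>vecs I n.
      let q = (vec_inner I n (opmat_apply n T xi) xi + vec_inner I n xi (opmat_apply n T xi)) / 2
      in Im q = 0 \<and> Re q \<ge> 0)"

definition opmat_norm :: "'i set \<Rightarrow> nat \<Rightarrow> (nat \<Rightarrow> nat \<Rightarrow> (('i \<Rightarrow> complex) \<Rightarrow> ('i \<Rightarrow> complex))) \<Rightarrow> real" where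
  "opmat_norm I n T = Sup {vec_norm I n (opmat_apply n T xi) | xi. xi \<in> vecs I n \<and> vec_norm I n xi \<le> 1}"

definition entrywise :: "('z \<Rightarrow> 'b) \<Rightarrow> (nat \<Rightarrow> nat \<Rightarrow> 'z) \<Rightarrow> (nat \<Rightarrow> nat \<Rightarrow> 'b)" where
  "entrywise phi A = (\<lambda>i j. phi (A i j))"

definition real_complete_order_embedding :: "(complex \<Rightarrow> 'z \<Rightarrow> 'z::ab_group_add) \<Rightarrow> (nat \<Rightarrow> (nat \<Rightarrow> nat \<Rightarrow> 'z) set)
    \<Rightarrow> 'i set \<Rightarrow> ('z \<Rightarrow> (('i \<Rightarrow> complex) \<Rightarrow> ('i \<Rightarrow> complex))) \<Rightarrow> bool" where
  "real_complete_order_embedding sc C I phi \<longleftrightarrow>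
     (\<forall>z. phi z \<in> bops I)
   \<and> (\<forall>z w. phi (z + w) = (\<lambda>f. phi z f + phi w f))
   \<and> (\<forall>c z. phi (sc c z) = (\<lambda>f x. c * phi z f x))
   \<and> inj phi
   \<and> (\<forall>n\<ge>1. \<forall>A\<in>C n. opmat_accretive I n (entrywise phi A))
   \<and> (\<forall>n\<ge>1. \<forall>A\<in>mats n. opmat_accretive I n (entrywise phi A) \<longrightarrow> A \<in> C n)"

end

theory Submission
  imports Defs
begin

text \<open>The representation is a direct sum of finite-dimensional ones. If \<open>a \<in> M\<^sub>n(Z)\<close> is not accretive,
  the Archimedean property and Zorn's lemma give a real functional that is nonnegative on the
  accretive cone of \<open>M\<^sub>n(Z)\<close> and negative at \<open>a\<close>. Its complexification, read as a map from \<open>Z\<close> to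
  \<open>M\<^sub>n\<close>, is real-completely positive since its amplifications evaluate the functional on congruences.
  After a small perturbation the image of \<open>e\<close> is positive definite, and conjugating by an
  orthonormal basis for that form makes the map unital without losing the separation. Summing over
  all unital real-completely positive maps into matrix algebras gives the order embedding. The norm
  identity follows because \<open>t\<close> times the identity minus the corner matrix of \<open>2 T\<close> is accretive
  iff \<open>\<parallel>T\<parallel> \<le> t\<close>.\<close>

subsection \<open>Square-summable families\<close>

text \<open>\<open>Z\<close> carries no adjoint operation and its cones are not confined to
  self-adjoint elements, so positivity is tested by real parts of quadratic forms and separation is
  done over the reals. The obstacle to a unital map is that the image of \<open>e\<close> under the
  map read off from a separating functional may be singular. The perturbation removes this kernel,
  after which a finite Gram-Schmidt argument takes the place of a quotient or a dilation.

  Summing over all unital maps makes the two order directions independent: every summand respects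
  the cones, and each non-accretive matrix is detected by some summand. An infinite sum is a bounded
  operator only if its blocks are bounded uniformly. The bound at \<open>z\<close> is any
  \<open>t\<close> for which \<open>t\<close> times the unit minus the corner matrix of
  \<open>2 z\<close> is accretive; it depends on \<open>z\<close> alone, so the estimate behind the
  norm identity also yields boundedness.

  The index set has to fit into the type \<open>'z \<Rightarrow> complex\<close>. It does, because
  two natural numbers and a complex matrix for each \<open>z\<close> can be packed into one complex
  number.\<close>

lemma l2_summable: "f \<in> l2 I \<Longrightarrow> (\<lambda>x. (cmod (f x))\<^sup>2) summable_on I"
  by (simp add: l2_def)

lemma l2_outside: "f \<in> l2 I \<Longrightarrow> x \<notin> I \<Longrightarrow> f x = 0"
  by (simp add: l2_def)

lemma l2_mult_summable:
  assumes "f \<in> l2 I" "g \<in> l2 I"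
  shows "(\<lambda>x. f x * cnj (g x)) summable_on I"
proof (rule abs_summable_summable, rule summable_on_comparison_test)
  show "(\<lambda>x. (cmod (f x))\<^sup>2 + (cmod (g x))\<^sup>2) summable_on I"
    using assms by (intro summable_on_add l2_summable)
  fix x
  have "2 * (cmod (f x) * cmod (g x)) \<le> (cmod (f x))\<^sup>2 + (cmod (g x))\<^sup>2"
    using sum_squares_bound[of "cmod (f x)" "cmod (g x)"] by simp
  moreover have "0 \<le> cmod (f x) * cmod (g x)" by simp
  ultimately show "norm (f x * cnj (g x)) \<le> (cmod (f x))\<^sup>2 + (cmod (g x))\<^sup>2"
    unfolding norm_mult complex_mod_cnj by linarith
qed auto

lemma l2_lincomb:
  assumes "f \<in> l2 I" "g \<in> l2 I"
  shows "(\<lambda>x. a * f x + b * g x) \<in> l2 I"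
proof -
  have "(\<lambda>x. (cmod (a * f x + b * g x))\<^sup>2) summable_on I"
  proof (rule summable_on_comparison_test)
    show "(\<lambda>x. 2 * (cmod a)\<^sup>2 * (cmod (f x))\<^sup>2 + 2 * (cmod b)\<^sup>2 * (cmod (g x))\<^sup>2) summable_on I"
      using assms by (intro summable_on_add summable_on_cmult_right l2_summable)
    fix x
    have "(cmod (a * f x + b * g x))\<^sup>2 \<le> (cmod (a * f x) + cmod (b * g x))\<^sup>2"
      by (intro power_mono norm_triangle_ineq norm_ge_zero)
    also have "\<dots> \<le> 2 * (cmod (a * f x))\<^sup>2 + 2 * (cmod (b * g x))\<^sup>2"
      using sum_squares_bound[of "cmod (a * f x)" "cmod (b * g x)"]
      by (simp add: power2_sum)
    finally show "(cmod (a * f x + b * g x))\<^sup>2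
        \<le> 2 * (cmod a)\<^sup>2 * (cmod (f x))\<^sup>2 + 2 * (cmod b)\<^sup>2 * (cmod (g x))\<^sup>2"
      by (simp add: norm_mult power_mult_distrib)
  qed auto
  then show ?thesis using assms by (simp add: l2_def)
qed

lemma l2_zero: "(\<lambda>_. 0) \<in> l2 I"
  by (simp add: l2_def)

lemma l2_add: "f \<in> l2 I \<Longrightarrow> g \<in> l2 I \<Longrightarrow> (\<lambda>x. f x + g x) \<in> l2 I"
  using l2_lincomb[of f I g 1 1] by simp

lemma l2_scale: "f \<in> l2 I \<Longrightarrow> (\<lambda>x. a * f x) \<in> l2 I"
  using l2_lincomb[of f I "\<lambda>_. 0" a 0] by (simp add: l2_zero)

lemma l2_sum:
  "(\<And>k. k \<in> K \<Longrightarrow> f k \<in> l2 I) \<Longrightarrow> (\<lambda>x. \<Sum>k\<in>K. f k x) \<in> l2 I"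
  by (induction K rule: infinite_finite_induct) (auto intro: l2_add l2_zero)

lemma l2_inner_add:
  assumes "f \<in> l2 I" "g \<in> l2 I" "h \<in> l2 I"
  shows "l2_inner I (\<lambda>x. f x + g x) h = l2_inner I f h + l2_inner I g h"
  using assms by (simp add: l2_inner_def distrib_right infsum_add l2_mult_summable)

lemma l2_inner_scale: "l2_inner I (\<lambda>x. a * f x) h = a * l2_inner I f h"
  by (simp add: l2_inner_def mult.assoc infsum_cmult_right')

lemma l2_inner_sum:
  assumes "h \<in> l2 I" "\<And>k. k \<in> K \<Longrightarrow> f k \<in> l2 I"
  shows "l2_inner I (\<lambda>x. \<Sum>k\<in>K. f k x) h = (\<Sum>k\<in>K. l2_inner I (f k) h)"
  using assms(2)
proof (induction K rule: infinite_finite_induct)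
  case (insert k K)
  then show ?case using assms(1) by (simp add: l2_inner_add l2_sum)
qed (simp_all add: l2_inner_def)

lemma l2_inner_commute: "l2_inner I g f = cnj (l2_inner I f g)"
  by (simp add: l2_inner_def flip: infsum_cnj) (simp add: mult.commute)

lemma l2_norm_nonneg: "0 \<le> l2_norm I f"
  by (simp add: l2_norm_def infsum_nonneg)

lemma l2_norm_sq: "(l2_norm I f)\<^sup>2 = infsum (\<lambda>x. (cmod (f x))\<^sup>2) I"
  by (simp add: l2_norm_def infsum_nonneg)

lemma l2_inner_self:
  assumes "f \<in> l2 I"
  shows "l2_inner I f f = of_real ((l2_norm I f)\<^sup>2)"
proof -
  have "((\<lambda>x. (cmod (f x))\<^sup>2) has_sum (l2_norm I f)\<^sup>2) I"
    using l2_summable[OF assms] by (simp add: l2_norm_sq)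
  then have "((\<lambda>x. complex_of_real ((cmod (f x))\<^sup>2)) has_sum of_real ((l2_norm I f)\<^sup>2)) I"
    by (simp only: has_sum_of_real_iff)
  then show ?thesis
    unfolding l2_inner_def complex_norm_square by (rule infsumI)
qed

lemma l2_norm_scale: "l2_norm I (\<lambda>x. a * f x) = cmod a * l2_norm I f"
  by (simp add: l2_norm_def norm_mult power_mult_distrib infsum_cmult_right' real_sqrt_mult)

text \<open>Termwise this is the weighted arithmetic-geometric mean inequality, from the square of
  \<open>cmod (f x) - t * cmod (g x)\<close>. It does the work of Cauchy-Schwarz in
  \<open>corner2_C_iff\<close>, where \<open>t\<close> is already the weight on the
  diagonal.\<close>

lemma l2_inner_young:
  assumes "f \<in> l2 I" "g \<in> l2 I" "t > 0"
  shows "2 * Re (l2_inner I f g) \<le> (l2_norm I f)\<^sup>2 / t + t * (l2_norm I g)\<^sup>2"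
proof -
  have "2 * Re (l2_inner I f g) = infsum (\<lambda>x. 2 * Re (f x * cnj (g x))) I"
    unfolding l2_inner_def
    by (subst infsum_Re[symmetric]) (simp_all only: l2_mult_summable[OF assms(1,2)] infsum_cmult_right')
  also have "\<dots> \<le> infsum (\<lambda>x. (cmod (f x))\<^sup>2 / t + t * (cmod (g x))\<^sup>2) I"
  proof (rule infsum_mono)
    show "(\<lambda>x. 2 * Re (f x * cnj (g x))) summable_on I"
      by (intro summable_on_cmult_right summable_on_Re l2_mult_summable assms)
    show "(\<lambda>x. (cmod (f x))\<^sup>2 / t + t * (cmod (g x))\<^sup>2) summable_on I"
      unfolding divide_inverse
      by (intro summable_on_add summable_on_cmult_right summable_on_cmult_left l2_summable assms)
    fix x
    have "Re (f x * cnj (g x)) \<le> cmod (f x) * cmod (g x)"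
      using complex_Re_le_cmod[of "f x * cnj (g x)"] by (simp add: norm_mult)
    moreover have "0 \<le> (cmod (f x) - t * cmod (g x))\<^sup>2 / t"
      using assms(3) by simp
    then have "2 * (cmod (f x) * cmod (g x)) \<le> (cmod (f x))\<^sup>2 / t + t * (cmod (g x))\<^sup>2"
      using assms(3) by (simp add: power2_diff field_simps power2_eq_square)
    ultimately show "2 * Re (f x * cnj (g x)) \<le> (cmod (f x))\<^sup>2 / t + t * (cmod (g x))\<^sup>2"
      by simp
  qed
  also have "\<dots> = (l2_norm I f)\<^sup>2 / t + t * (l2_norm I g)\<^sup>2"
    unfolding l2_norm_sq divide_inverse
    by (subst infsum_add)
      (auto simp: infsum_cmult_right' infsum_cmult_left' intro!: summable_on_cmult_right summable_on_cmult_left l2_summable assms)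
  finally show ?thesis .
qed

subsection \<open>Separation from Archimedean cones\<close>

text \<open>In a total preorder with order unit \<open>u\<close>, each \<open>x\<close> cuts the
  real line into the \<open>t\<close> with \<open>t u\<close> below \<open>x\<close> and the
  \<open>t\<close> with \<open>t u\<close> above \<open>x\<close>. The functional is the cut point:
  totality makes the two sets cover the line, and \<open>- u \<notin> K\<close> prevents an overlap
  of positive length. Additivity and homogeneity hold because cuts can be added and scaled.\<close>

lemma total_cone_functional:
  fixes s :: "real \<Rightarrow> 'v::ab_group_add \<Rightarrow> 'v"
  assumes vs: "vector_space s"
    and add: "\<And>a b. a \<in> K \<Longrightarrow> b \<in> K \<Longrightarrow> a + b \<in> K"
    and scale: "\<And>a t. a \<in> K \<Longrightarrow> 0 \<le> t \<Longrightarrow> s t a \<in> K"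
    and unit: "\<And>x. \<exists>t>0. s t u + x \<in> K"
    and proper: "- u \<notin> K"
    and total: "\<And>x. x \<in> K \<or> - x \<in> K"
  obtains g :: "'v \<Rightarrow> real"
  where "\<And>x y. g (x + y) = g x + g y" "\<And>r x. g (s r x) = r * g x"
    "g u = 1" "\<And>x. x \<in> K \<Longrightarrow> 0 \<le> g x"
proof -
  interpret vector_space s by (rule vs)
  have neg_unit: "s r u \<notin> K" if "r < 0" for r
    using scale[of "s r u" "1 / - r"] that proper by auto
  have u: "u \<in> K"
    using total proper by blast
  define g where "g x = Sup {t. x - s t u \<in> K}" for x
  have lower: "x - s t u \<in> K" and upper: "t' > g x \<Longrightarrow> s t' u - x \<in> K" if "t < g x" for x t t'
  proof -
    have mono: "x - s a u \<in> K" if "x - s b u \<in> K" "a \<le> b" for a b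
      using add[OF that(1) scale[OF u, of "b - a"]] that(2) by (simp add: scale_left_diff_distrib)
    obtain b where b: "s b u - x \<in> K"
      using unit[of "- x"] by auto
    obtain c where c: "s c u + x \<in> K"
      using unit by blast
    have bdd: "bdd_above {t. x - s t u \<in> K}"
    proof (rule bdd_aboveI)
      fix t assume "t \<in> {t. x - s t u \<in> K}"
      then have "s (b - t) u \<in> K"
        using add[OF b, of "x - s t u"] by (simp add: scale_left_diff_distrib)
      then show "t \<le> b" using neg_unit[of "b - t"] by force
    qed
    have ne: "{t. x - s t u \<in> K} \<noteq> {}"
      using c by (auto intro!: exI[of _ "- c"] simp: add.commute)
    show "x - s t u \<in> K"
      using that ne bdd mono unfolding g_def by (subst (asm) less_cSup_iff) auto
    assume "t' > g x"
    then have "x - s t' u \<notin> K"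
      using cSup_upper[OF _ bdd, of t'] unfolding g_def by force
    then show "s t' u - x \<in> K"
      using total[of "x - s t' u"] by simp
  qed
  \<comment> \<open>The joint statement above carries the premise \<open>t < g x\<close> for both of
    its conclusions; any number below \<open>g x\<close> discharges it.\<close>
  have upper: "s t u - x \<in> K" if "t > g x" for x t
    using upper[of "g x - 1" x t] that by simp
  have cross: "b \<le> a" if "s a u - x \<in> K" "x - s b u \<in> K" for a b x
    using add[OF that] neg_unit[of "a - b"] by (force simp: scale_left_diff_distrib)
  \<comment> \<open>A cut point is determined by the strict inequalities on both sides, so
    membership at the cut point itself never has to be decided.\<close>
  have g_eqI: "g x = r" if "\<And>t. t < r \<Longrightarrow> x - s t u \<in> K" "\<And>t. t > r \<Longrightarrow> s t u - x \<in> K" for x r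
  proof (rule ccontr)
    assume "g x \<noteq> r"
    then consider "g x < r" | "r < g x" by linarith
    then show False
    proof cases
      case 1
      then obtain a b where "g x < a" "a < b" "b < r" using dense by metis
      then show False using cross[OF upper that(1)] by force
    next
      case 2
      then obtain a b where "r < a" "a < b" "b < g x" using dense by metis
      then show False using cross[OF that(2) lower] by force
    qed
  qed
  have g_add: "g (x + y) = g x + g y" for x y
  proof (rule g_eqI)
    fix t assume "t < g x + g y"
    \<comment> \<open>Half of the gap \<open>g x + g y - t\<close> is taken off each summand, so
      both stay strictly below their cut points and add up to \<open>t\<close>.\<close>
    then have "x - s (g x - (g x + g y - t) / 2) u \<in> K" "y - s (g y - (g x + g y - t) / 2) u \<in> K"
      by (auto intro!: lower)
    from add[OF this] have "x + y - s ((g x - (g x + g y - t) / 2) + (g y - (g x + g y - t) / 2)) u \<in> K"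
      by (simp only: scale_left_distrib) (simp add: algebra_simps)
    then show "x + y - s t u \<in> K" by (simp add: field_simps)
  next
    fix t assume "t > g x + g y"
    then have "s (g x + (t - g x - g y) / 2) u - x \<in> K" "s (g y + (t - g x - g y) / 2) u - y \<in> K"
      by (auto intro!: upper)
    from add[OF this] have "s ((g x + (t - g x - g y) / 2) + (g y + (t - g x - g y) / 2)) u - (x + y) \<in> K"
      by (simp only: scale_left_distrib) (simp add: algebra_simps)
    then show "s t u - (x + y) \<in> K" by (simp add: field_simps)
  qed
  have g_zero: "g 0 = 0"
    using g_add[of 0 0] by simp
  have g_minus: "g (- x) = - g x" for x
    using g_add[of x "- x"] g_zero by simp
  have g_pos: "g (s r x) = r * g x" if r: "r > 0" for r x
  proof (rule g_eqI)
    fix t assume "t < r * g x"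
    then have "x - s (t / r) u \<in> K" using r by (intro lower) (simp add: field_simps)
    from scale[OF this, of r] show "s r x - s t u \<in> K"
      using r by (simp add: scale_right_diff_distrib)
  next
    fix t assume "t > r * g x"
    then have "s (t / r) u - x \<in> K" using r by (intro upper) (simp add: field_simps)
    from scale[OF this, of r] show "s t u - s r x \<in> K"
      using r by (simp add: scale_right_diff_distrib)
  qed
  show ?thesis
  proof
    show "g (s r x) = r * g x" for r x
    proof (cases r "0::real" rule: linorder_cases)
      case less
      then show ?thesis using g_pos[of "- r" x] g_minus[of "s r x"] by simp
    qed (simp_all add: g_zero g_pos)
    show "g u = 1"
    proof (rule g_eqI)
      fix t :: real
      show "u - s t u \<in> K" if "t < 1"
        using scale[OF u, of "1 - t"] that by (simp add: scale_left_diff_distrib)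
      show "s t u - u \<in> K" if "t > 1"
        using scale[OF u, of "t - 1"] that by (simp add: scale_left_diff_distrib)
    qed
    \<comment> \<open>\<open>x \<in> K\<close> says that 0 lies in the lower part of the cut of
      \<open>x\<close>, while \<open>g x + e\<close> lies in the upper part for every positive
      \<open>e\<close>.\<close>
    show "0 \<le> g x" if "x \<in> K" for x
      using cross[of "g x + e" x 0 for e] upper[of x] that
      by (metis add.commute add_0 diff_zero field_le_epsilon less_add_same_cancel1 scale_zero_left)
  qed (rule g_add)
qed

text \<open>A cone containing \<open>K\<close> and \<open>- a\<close> that is maximal among those omitting \<open>- u\<close> is total.\<close>
lemma cone_separation:
  fixes s :: "real \<Rightarrow> 'v::ab_group_add \<Rightarrow> 'v"
  assumes vs: "vector_space s"
    and add: "\<And>a b. a \<in> K \<Longrightarrow> b \<in> K \<Longrightarrow> a + b \<in> K"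
    and scale: "\<And>a t. a \<in> K \<Longrightarrow> 0 \<le> t \<Longrightarrow> s t a \<in> K"
    and unit: "\<And>x. \<exists>t>0. s t u + x \<in> K"
    and arch: "\<And>x. (\<And>t. t > 0 \<Longrightarrow> s t u + x \<in> K) \<Longrightarrow> x \<in> K"
    and a: "a \<notin> K"
  obtains g :: "'v \<Rightarrow> real"
  where "\<And>x y. g (x + y) = g x + g y" "\<And>r x. g (s r x) = r * g x"
    "g u = 1" "\<And>x. x \<in> K \<Longrightarrow> 0 \<le> g x" "g a < 0"
proof -
  interpret vector_space s by (rule vs)
  define cone where "cone L \<longleftrightarrow> (\<forall>a\<in>L. \<forall>b\<in>L. a + b \<in> L) \<and> (\<forall>a\<in>L. \<forall>t\<ge>0. s t a \<in> L)" for L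
  have cone_hull: "cone {k + s r b | k r. k \<in> L \<and> 0 \<le> r}" if "cone L" for L b
    unfolding cone_def
  proof (intro conjI ballI allI impI)
    fix x y assume "x \<in> {k + s r b | k r. k \<in> L \<and> 0 \<le> r}" "y \<in> {k + s r b | k r. k \<in> L \<and> 0 \<le> r}"
    then obtain k r k' r' where "x = k + s r b" "y = k' + s r' b" "k \<in> L" "k' \<in> L" "0 \<le> r" "0 \<le> r'"
      by blast
    then have "x + y = (k + k') + s (r + r') b" "k + k' \<in> L" "0 \<le> r + r'"
      using that by (auto simp: cone_def scale_left_distrib)
    then show "x + y \<in> {k + s r b | k r. k \<in> L \<and> 0 \<le> r}" by blast
  next
    fix x and t :: real assume "x \<in> {k + s r b | k r. k \<in> L \<and> 0 \<le> r}" "0 \<le> t"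
    then obtain k r where "x = k + s r b" "k \<in> L" "0 \<le> r"
      by blast
    then have "s t x = s t k + s (t * r) b" "s t k \<in> L" "0 \<le> t * r"
      using that \<open>0 \<le> t\<close> by (auto simp: cone_def scale_right_distrib)
    then show "s t x \<in> {k + s r b | k r. k \<in> L \<and> 0 \<le> r}" by blast
  qed
  have hull_base: "L \<subseteq> {k + s r b | k r. k \<in> L \<and> 0 \<le> r}" for L b
  proof
    fix x assume "x \<in> L"
    moreover have "x = x + s 0 b" by simp
    ultimately show "x \<in> {k + s r b | k r. k \<in> L \<and> 0 \<le> r}" by blast
  qed
  have coneK: "cone K" using add scale by (simp add: cone_def)
  obtain t where t: "t > 0" "s t u + a \<notin> K" using arch[of a] a by auto
  \<comment> \<open>Adjoining \<open>b\<close> instead of \<open>- a\<close> keeps a margin: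
    \<open>0 \<le> g b\<close> reads \<open>g a \<le> - t\<close>, which makes the final inequality
    strict.\<close>
  define b where "b = - (s t u + a)"
  define K' where "K' = {k + s r b | k r. k \<in> K \<and> 0 \<le> r}"
  obtain t0 where "t0 > 0" "s t0 u \<in> K" using unit[of 0] by auto
  then have u: "u \<in> K" using scale[of "s t0 u" "1 / t0"] by simp
  then have zero: "0 \<in> K" using scale[of u 0] by simp
  have neg: "- u \<notin> K"
  proof
    assume "- u \<in> K"
    then have "s r u + a \<in> K" for r
    proof -
      obtain q where q: "q > 0" "s q u + a \<in> K" using unit by blast
      show ?thesis
      proof (cases "r \<ge> q")
        case True
        then show ?thesis using add[OF q(2) scale[OF u, of "r - q"]]
          by (simp add: scale_left_diff_distrib add.commute)
      next
        case False
        then show ?thesis using add[OF q(2) scale[OF \<open>- u \<in> K\<close>, of "q - r"]]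
          by (simp add: scale_left_diff_distrib add.commute)
      qed
    qed
    from this[of t] show False using t(2) by simp
  qed
  have neg': "- u \<notin> K'"
  proof
    assume "- u \<in> K'"
    then obtain k r where kr: "- u = k + s r b" "k \<in> K" "0 \<le> r" by (auto simp: K'_def)
    with neg have "r > 0" by (cases "r = 0") auto
    have "s r (s t u + a) = u + k" 
      using kr(1) by (simp add: b_def algebra_simps)
    then have "s r (s t u + a) \<in> K" using add[OF u kr(2)] by simp
    from scale[OF this, of "1 / r"] \<open>r > 0\<close> t(2) show False by simp
  qed
  define F where "F = {L. cone L \<and> K' \<subseteq> L \<and> - u \<notin> L}"
  have "\<exists>M\<in>F. \<forall>X\<in>F. M \<subseteq> X \<longrightarrow> X = M"
  proof (rule subset_Zorn_nonempty)
    have "K' \<in> F" using cone_hull[OF coneK, of b] neg' by (simp add: F_def flip: K'_def)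
    then show "F \<noteq> {}" by blast
    fix Ch assume Ch: "Ch \<noteq> {}" "subset.chain F Ch"
    have ChF: "\<And>L. L \<in> Ch \<Longrightarrow> cone L \<and> K' \<subseteq> L \<and> - u \<notin> L"
      and tot: "\<And>L M. L \<in> Ch \<Longrightarrow> M \<in> Ch \<Longrightarrow> L \<subseteq> M \<or> M \<subseteq> L"
      using Ch(2) by (auto simp: subset_chain_def F_def)
    have "cone (\<Union>Ch)"
      unfolding cone_def
    proof (intro conjI ballI allI impI)
      fix x y assume "x \<in> \<Union>Ch" "y \<in> \<Union>Ch"
      then obtain L M where "L \<in> Ch" "M \<in> Ch" "x \<in> L" "y \<in> M" by blast
      with tot[of L M] obtain N where "N \<in> Ch" "x \<in> N" "y \<in> N" by blast
      then show "x + y \<in> \<Union>Ch" using ChF[of N] by (auto simp: cone_def)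
    next
      fix x and r :: real assume "x \<in> \<Union>Ch" "0 \<le> r"
      then obtain L where "L \<in> Ch" "x \<in> L" by blast
      then show "s r x \<in> \<Union>Ch" using ChF[of L] \<open>0 \<le> r\<close> by (auto simp: cone_def intro!: bexI[of _ L])
    qed
    then show "\<Union>Ch \<in> F" using ChF Ch(1) by (auto simp: F_def)
  qed
  then obtain M where MF: "M \<in> F" and maxF: "\<And>X. X \<in> F \<Longrightarrow> M \<subseteq> X \<Longrightarrow> X = M"
    by auto
  have M: "cone M" "K' \<subseteq> M" "- u \<notin> M"
    using MF by (simp_all add: F_def)
  have max: "X = M" if "cone X" "M \<subseteq> X" "- u \<notin> X" for X
    using that M(2) by (intro maxF) (auto simp: F_def)
  have KK': "K \<subseteq> K'" unfolding K'_def by (rule hull_base)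
  \<comment> \<open>If the cone generated by \<open>M\<close> and \<open>x\<close> contained
    \<open>- u\<close>, then a positive multiple of \<open>- x\<close> would lie in
    \<open>M\<close>. So when \<open>- x\<close> is not in \<open>M\<close>, that cone is admissible
    and maximality puts \<open>x\<close> into \<open>M\<close>.\<close>
  have total: "x \<in> M \<or> - x \<in> M" for x
  proof (rule disjCI)
    assume nx: "- x \<notin> M"
    let ?X = "{k + s r x | k r. k \<in> M \<and> 0 \<le> r}"
    have 1: "M \<subseteq> ?X" by (rule hull_base)
    have "0 + s 1 x \<in> ?X" using M(2) KK' zero by (intro CollectI exI[of _ 0] exI[of _ "1::real"]) auto
    then have 2: "x \<in> ?X" by (simp only: scale_one add_0)
    have "- u \<notin> ?X"
    proof
      assume "- u \<in> ?X"
      then obtain k r where kr: "- u = k + s r x" "k \<in> M" "0 \<le> r" by blast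
      with M(3) have "r > 0" by (cases "r = 0") auto
      have "u + k \<in> M" using M KK' u kr(2) by (auto simp: cone_def)
      moreover have "u + k = s r (- x)"
      proof -
        have "s r x = - u - k" using kr(1) by simp
        then show ?thesis by simp
      qed
      ultimately have "s r (- x) \<in> M" by (simp only:)
      moreover have "\<forall>a\<in>M. \<forall>t\<ge>0. s t a \<in> M" using M(1) by (simp add: cone_def)
      ultimately have "s (1 / r) (s r (- x)) \<in> M"
        using \<open>r > 0\<close> by (simp del: scale_scale scale_minus_right)
      then show False using \<open>r > 0\<close> nx by simp
    qed
    from max[OF cone_hull[OF M(1)] 1 this] 2 show "x \<in> M" by simp
  qed
  have M_add: "x + y \<in> M" if "x \<in> M" "y \<in> M" for x y
    using M(1) that by (simp add: cone_def)
  have M_scale: "s r x \<in> M" if "x \<in> M" "0 \<le> r" for x r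
    using M(1) that by (simp add: cone_def)
  have M_unit: "\<exists>r>0. s r u + x \<in> M" for x
  proof -
    obtain r where "r > 0" "s r u + x \<in> K" using unit by blast
    then show ?thesis using KK' M(2) by auto
  qed
  obtain g where g: "\<And>x y. g (x + y) = g x + g y" "\<And>r x. g (s r x) = r * g x"
    "g u = 1" "\<And>x. x \<in> M \<Longrightarrow> 0 \<le> g x"
  proof (rule total_cone_functional[OF vs M_add M_scale M_unit M(3) total])
    fix g :: "'v \<Rightarrow> real"
    assume "\<And>x y. g (x + y) = g x + g y" "\<And>r x. g (s r x) = r * g x"
      "g u = 1" "\<And>x. x \<in> M \<Longrightarrow> 0 \<le> g x"
    then show thesis by (rule that)
  qed
  have "0 + s 1 b \<in> K'" unfolding K'_def using zero by (intro CollectI exI[of _ 0] exI[of _ "1::real"]) auto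
  then have "0 \<le> g b" using M(2) g(4) by auto
  moreover have "g 0 = 0" using g(1)[of 0 0] by simp
  then have "g b + (t + g a) = 0"
    using g(1)[of b "s t u + a"] g(1)[of "s t u" a] g(2)[of t u] g(3) by (simp add: b_def)
  ultimately have "g a < 0" using t(1) by linarith
  moreover have "0 \<le> g x" if "x \<in> K" for x
    using that KK' M(2) by (intro g(4)) auto
  ultimately show ?thesis using that[OF g(1-3)] by simp
qed

subsection \<open>Positive definite sesquilinear forms\<close>

definition sform :: "nat \<Rightarrow> (nat \<Rightarrow> nat \<Rightarrow> complex) \<Rightarrow> (nat \<Rightarrow> complex) \<Rightarrow> (nat \<Rightarrow> complex) \<Rightarrow> complex" where
  "sform n P x y = (\<Sum>i<n. \<Sum>j<n. P i j * x j * cnj (y i))"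

lemma sform_add_left: "sform n P (\<lambda>i. x i + y i) z = sform n P x z + sform n P y z"
  and sform_add_right: "sform n P z (\<lambda>i. x i + y i) = sform n P z x + sform n P z y"
  and sform_scale_left: "sform n P (\<lambda>i. c * x i) z = c * sform n P x z"
  and sform_scale_right: "sform n P z (\<lambda>i. c * x i) = cnj c * sform n P z x"
  by (simp_all add: sform_def algebra_simps sum.distrib sum_distrib_left)

lemma sform_sum_left: "sform n P (\<lambda>i. \<Sum>k\<in>K. c k * b k i) z = (\<Sum>k\<in>K. c k * sform n P (b k) z)"
proof (induction K rule: infinite_finite_induct)
  case (insert k K)
  then show ?case by (simp add: sform_add_left sform_scale_left)
qed (simp_all add: sform_def)

lemma sform_sum_right: "sform n P z (\<lambda>i. \<Sum>k\<in>K. c k * b k i) = (\<Sum>k\<in>K. cnj (c k) * sform n P z (b k))"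
proof (induction K rule: infinite_finite_induct)
  case (insert k K)
  then show ?case by (simp add: sform_add_right sform_scale_right)
qed (simp_all add: sform_def)

lemma sform_cong: "(\<And>i. i < n \<Longrightarrow> x i = x' i) \<Longrightarrow> (\<And>i. i < n \<Longrightarrow> y i = y' i) \<Longrightarrow> sform n P x y = sform n P x' y'"
  by (simp add: sform_def)

text \<open>Polarization: the values at \<open>x + y\<close> and \<open>x + \<i> y\<close> give the
  imaginary and the real part of the identity. No symmetry of the matrix \<open>P\<close> is
  assumed.\<close>

lemma sform_hermitian:
  assumes "\<And>x. Im (sform n P x x) = 0"
  shows "sform n P y x = cnj (sform n P x y)"
proof -
  have "Im (sform n P (\<lambda>i. x i + c * y i) (\<lambda>i. x i + c * y i)) = 0" for c
    by (rule assms)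
  from this[of 1] this[of \<i>] assms[of x] assms[of y] show ?thesis
    by (simp add: sform_add_left sform_add_right sform_scale_left sform_scale_right complex_eq_iff)
qed

text \<open>Gram-Schmidt applied to the standard basis. The induction keeps the first
  \<open>m\<close> vectors supported on the first \<open>m\<close> coordinates; this triangular
  shape guarantees that the next vector is nonzero, so \<open>pos\<close> applies to it.\<close>

lemma sform_orthonormal_basis:
  assumes herm: "\<And>x. Im (sform n P x x) = 0"
    and pos: "\<And>x i. i < n \<Longrightarrow> x i \<noteq> 0 \<Longrightarrow> 0 < Re (sform n P x x)"
  obtains b where "\<forall>k<n. \<forall>l<n. sform n P (b l) (b k) = (if k = l then 1 else 0)"
    "\<forall>v. \<exists>c. \<forall>i<n. v i = (\<Sum>k<n. c k * b k i)"
proof -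
  have "\<exists>b. (\<forall>k<m. \<forall>l<m. sform n P (b l) (b k) = (if k = l then 1 else 0))
      \<and> (\<forall>k<m. \<forall>i\<ge>m. b k i = 0)
      \<and> (\<forall>v. \<exists>c. \<forall>i<m. v i = (\<Sum>k<m. c k * b k i))" if "m \<le> n" for m
    using that
  proof (induction m)
    case 0
    then show ?case by simp
  next
    case (Suc m)
    from Suc.IH[OF Suc_leD[OF Suc.prems]] obtain b where b:
        "(\<forall>k<m. \<forall>l<m. sform n P (b l) (b k) = (if k = l then 1 else 0))
          \<and> (\<forall>k<m. \<forall>i\<ge>m. b k i = 0) \<and> (\<forall>v. \<exists>c. \<forall>i<m. v i = (\<Sum>k<m. c k * b k i))"
      by (elim exE)
    then have orth: "\<And>k l. k < m \<Longrightarrow> l < m \<Longrightarrow> sform n P (b l) (b k) = (if k = l then 1 else 0)"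
      and supp: "\<And>k i. k < m \<Longrightarrow> i \<ge> m \<Longrightarrow> b k i = 0"
      by simp_all
    have span: "\<exists>c. \<forall>i<m. v i = (\<Sum>k<m. c k * b k i)" for v
      using b by (elim conjE) (erule spec)
    define d :: "nat \<Rightarrow> complex" where "d i = (if i = m then 1 else 0)" for i
    define a where "a k = - sform n P d (b k)" for k
    \<comment> \<open>The \<open>m\<close>-th standard basis vector minus its projection to the span
      of the earlier \<open>b k\<close>. The latter vanish at \<open>m\<close>, hence
      \<open>v m = 1\<close>.\<close>
    define v where "v i = d i + (\<Sum>k<m. a k * b k i)" for i
    have vm: "v m = 1" by (simp add: v_def d_def supp)
    have v_orth: "sform n P v (b l) = 0" if "l < m" for l
    proof -
      have "sform n P v (b l) = sform n P d (b l) + (\<Sum>k<m. a k * sform n P (b k) (b l))"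
        unfolding v_def by (simp add: sform_add_left sform_sum_left)
      also have "(\<Sum>k<m. a k * sform n P (b k) (b l)) = (\<Sum>k<m. if k = l then a l else 0)"
        using that by (intro sum.cong) (auto simp: orth)
      finally show ?thesis using that by (simp add: a_def)
    qed
    define r where "r = Re (sform n P v v)"
    have r: "r > 0" "sform n P v v = of_real r"
      using pos[of m v] herm[of v] Suc.prems vm by (simp_all add: r_def complex_eq_iff)
    define \<rho> :: complex where "\<rho> = of_real (1 / sqrt r)"
    define b' where "b' k = (if k = m then (\<lambda>i. \<rho> * v i) else b k)" for k
    have "1 / sqrt r * (1 / sqrt r) * r = 1"
      using r(1) by (simp add: field_simps)
    then have "\<rho> * (cnj \<rho> * of_real r) = 1"
      unfolding \<rho>_def by (simp only: complex_cnj_complex_of_real mult.assoc flip: of_real_mult) simp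
    then have bm: "sform n P (b' m) (b' m) = 1"
      using r(2) by (simp add: b'_def sform_scale_left sform_scale_right)
    have "sform n P (b' l) (b' k) = (if k = l then 1 else 0)" if kl: "k < Suc m" "l < Suc m" for k l
    proof -
      have mixed: "sform n P (b' m) (b' l) = 0 \<and> sform n P (b' l) (b' m) = 0" if "l < m" for l
        using v_orth[OF that] that sform_hermitian[OF herm, of v "b l"]
        by (simp add: b'_def sform_scale_left sform_scale_right)
      consider "k < m" "l < m" | "k = m" "l < m" | "k < m" "l = m" | "k = m" "l = m"
        using kl by linarith
      then show ?thesis
      proof cases
        case 1
        then show ?thesis by (simp add: b'_def orth)
      qed (use mixed bm in auto)
    qed
    moreover have "b' k i = 0" if "k < Suc m" "i \<ge> Suc m" for k i
      using that by (auto simp: b'_def v_def d_def supp)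
    moreover have "\<exists>c. \<forall>i<Suc m. w i = (\<Sum>k<Suc m. c k * b' k i)" for w
    proof -
      \<comment> \<open>Subtracting \<open>w m * v\<close> clears coordinate \<open>m\<close>, so
        the induction hypothesis covers the rest. The new coefficient \<open>w m * sqrt r\<close>
        undoes the normalisation of \<open>v\<close> by \<open>\<rho>\<close>.\<close>
      obtain c where c: "\<forall>i<m. w i - w m * v i = (\<Sum>k<m. c k * b k i)"
        using span[of "\<lambda>i. w i - w m * v i"] by blast
      then have c': "w i = (\<Sum>k<m. c k * b k i) + w m * v i" if "i < m" for i
        using that by (metis diff_add_cancel)
      have "(\<Sum>k<Suc m. (c(m := w m * sqrt r)) k * b' k i) = (\<Sum>k<m. c k * b k i) + w m * v i" for i
        using r(1) by (simp add: b'_def \<rho>_def)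
      with c' vm supp show ?thesis
        by (intro exI[of _ "c(m := w m * sqrt r)"]) (auto simp: less_Suc_eq)
    qed
    ultimately show ?case by (intro exI[of _ b'] conjI allI impI)
  qed
  from this[OF order_refl] obtain b where
      "(\<forall>k<n. \<forall>l<n. sform n P (b l) (b k) = (if k = l then 1 else 0))
        \<and> (\<forall>k<n. \<forall>i\<ge>n. b k i = 0) \<and> (\<forall>v. \<exists>c. \<forall>i<n. v i = (\<Sum>k<n. c k * b k i))"
    by (elim exE)
  then show ?thesis by (intro that[of b]) simp_all
qed

lemma sform_change_basis:
  "(\<Sum>k<m. \<Sum>l<m. sform n P (b l) (b k) * x l * cnj (y k))
     = sform n P (\<lambda>j. \<Sum>l<m. x l * b l j) (\<lambda>i. \<Sum>k<m. y k * b k i)"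
  unfolding sform_sum_left sform_sum_right
  by (simp add: sum_distrib_left mult_ac) (rule sum.swap)

subsection \<open>Real-completely positive maps into matrix algebras\<close>

definition single :: "nat \<Rightarrow> nat \<Rightarrow> 'z::zero \<Rightarrow> nat \<Rightarrow> nat \<Rightarrow> 'z" where
  "single i j z = (\<lambda>p q. if p = i \<and> q = j then z else 0)"

text \<open>The projection to \<open>mats n\<close>. Linear structure is available on the whole
  function type, so \<open>C n\<close> is replaced by its preimage under \<open>trunc n\<close> when
  a functional is constructed.\<close>

definition trunc :: "nat \<Rightarrow> (nat \<Rightarrow> nat \<Rightarrow> 'z::zero) \<Rightarrow> nat \<Rightarrow> nat \<Rightarrow> 'z" where
  "trunc n A = (\<lambda>i j. if i < n \<and> j < n then A i j else 0)"

lemma trunc_mats: "A \<in> mats n \<Longrightarrow> trunc n A = A"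
  by (auto simp: trunc_def mats_def fun_eq_iff)

lemma trunc_in_mats: "trunc n A \<in> mats n"
  by (auto simp: trunc_def mats_def)

lemma trunc_eq_sum_single: "trunc n A = (\<Sum>i<n. \<Sum>j<n. single i j (A i j))"
  for A :: "nat \<Rightarrow> nat \<Rightarrow> 'z::ab_group_add"
proof (intro ext)
  fix p q
  have "(\<Sum>i<n. \<Sum>j<n. single i j (A i j)) p q = (\<Sum>i<n. \<Sum>j<n. single i j (A i j) p q)"
  proof -
    have *: "(\<Sum>i\<in>S. f i) x = (\<Sum>i\<in>S. f i x)" for S :: "nat set" and f :: "nat \<Rightarrow> nat \<Rightarrow> 'b::ab_group_add" and x
      by (induction S rule: infinite_finite_induct) auto
    have **: "(\<Sum>i\<in>S. f i) x = (\<Sum>i\<in>S. f i x)" for S :: "nat set" and f :: "nat \<Rightarrow> nat \<Rightarrow> nat \<Rightarrow> 'b::ab_group_add" and x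
      by (induction S rule: infinite_finite_induct) auto
    show ?thesis by (simp only: * **)
  qed
  also have "\<dots> = (\<Sum>i<n. if i = p then (\<Sum>j<n. if j = q then A p q else 0) else 0)"
    by (intro sum.cong) (auto simp: single_def)
  also have "\<dots> = trunc n A p q"
    by (simp add: trunc_def)
  finally show "trunc n A p q = (\<Sum>i<n. \<Sum>j<n. single i j (A i j)) p q" by simp
qed

section \<open>Cones, order unit and separating functionals\<close>

locale accretive_space =
  fixes sc :: "complex \<Rightarrow> 'z::ab_group_add \<Rightarrow> 'z"
    and C :: "nat \<Rightarrow> (nat \<Rightarrow> nat \<Rightarrow> 'z) set"
    and e :: 'z
  assumes aamou: "aamou_space sc C e"
begin

lemma vector_space_sc: "vector_space sc"
  using aamou by (simp add: aamou_space_def accretive_mos_def)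

sublocale vector_space sc by (rule vector_space_sc)

lemma C_mats: "1 \<le> n \<Longrightarrow> A \<in> C n \<Longrightarrow> A \<in> mats n"
  and C_add: "1 \<le> n \<Longrightarrow> A \<in> C n \<Longrightarrow> B \<in> C n \<Longrightarrow> A + B \<in> C n"
  and C_scale: "1 \<le> n \<Longrightarrow> A \<in> C n \<Longrightarrow> 0 \<le> t \<Longrightarrow> mscale sc (complex_of_real t) A \<in> C n"
  and C_congr: "1 \<le> n \<Longrightarrow> 1 \<le> k \<Longrightarrow> A \<in> C n \<Longrightarrow> congr sc n k X A \<in> C k"
  using aamou by (auto simp: aamou_space_def accretive_mos_def matrix_cone_def is_cone_def)

lemma C_unit: "1 \<le> n \<Longrightarrow> z \<in> mats n \<Longrightarrow> \<exists>t>0. mscale sc (complex_of_real t) (diagI e n) + z \<in> C n"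
  and C_arch: "1 \<le> n \<Longrightarrow> z \<in> mats n
    \<Longrightarrow> (\<And>t. t > 0 \<Longrightarrow> mscale sc (complex_of_real t) (diagI e n) + z \<in> C n) \<Longrightarrow> z \<in> C n"
  using aamou by (auto simp: aamou_space_def archimedean_mou_def accretive_mou_def)

lemma mscale_mscale: "mscale sc a (mscale sc b A) = mscale sc (a * b) A"
  by (simp add: mscale_def)

text \<open>The self-adjointness of \<open>e\<close> in usable form. A real-completely positive map
  sends both elements to matrices with nonnegative real part, which forces the quadratic form of the
  image of \<open>e\<close> to be real.\<close>

lemma C_unit_imaginary: "sgl (sc \<i> e) \<in> C 1" "sgl (sc (- \<i>) e) \<in> C 1"
proof -
  have "sgl e \<in> Zsa sc C 1"
    using aamou by (auto simp: aamou_space_def archimedean_mou_def accretive_mou_def)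
  then obtain A B where AB: "A \<in> C 1" "B \<in> C 1"
    and A: "sgl e = mscale sc \<i> A" and B: "sgl e = mscale sc (- \<i>) B"
    by (auto simp: Zsa_def)
  have one: "mscale sc 1 X = X" for X by (simp add: mscale_def)
  have "A = mscale sc (- \<i>) (sgl e)"
    unfolding A by (simp add: mscale_mscale one)
  moreover have "B = mscale sc \<i> (sgl e)"
    unfolding B by (simp add: mscale_mscale one)
  moreover have "mscale sc c (sgl e) = sgl (sc c e)" for c
    by (auto simp: mscale_def sgl_def fun_eq_iff)
  ultimately show "sgl (sc \<i> e) \<in> C 1" "sgl (sc (- \<i>) e) \<in> C 1"
    using AB by simp_all
qed

lemma vector_space_mscale: "vector_space (\<lambda>t. mscale sc (complex_of_real t))"
  by standard (auto simp: mscale_def fun_eq_iff scale_right_distrib scale_left_distrib)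

lemma trunc_add: "trunc n (A + B) = trunc n A + trunc n B" for A B :: "nat \<Rightarrow> nat \<Rightarrow> 'z"
  by (auto simp: trunc_def fun_eq_iff)

lemma trunc_scale: "trunc n (mscale sc c A) = mscale sc c (trunc n A)"
  by (auto simp: trunc_def mscale_def fun_eq_iff)

lemma trunc_diagI: "trunc n (diagI e n) = diagI e n"
  by (auto simp: trunc_def diagI_def fun_eq_iff)

definition real_linear :: "((nat \<Rightarrow> nat \<Rightarrow> 'z) \<Rightarrow> real) \<Rightarrow> bool" where
  "real_linear h \<longleftrightarrow> (\<forall>x y. h (x + y) = h x + h y)
     \<and> (\<forall>r x. h (mscale sc (complex_of_real r) x) = r * h x)"

lemma real_linear_add: "real_linear h \<Longrightarrow> h (x + y) = h x + h y"
  and real_linear_scale: "real_linear h \<Longrightarrow> h (mscale sc (complex_of_real r) x) = r * h x"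
  by (simp_all add: real_linear_def)

lemma C_separation:
  assumes n: "1 \<le> n" and a: "a \<in> mats n" "a \<notin> C n"
  obtains g :: "(nat \<Rightarrow> nat \<Rightarrow> 'z) \<Rightarrow> real"
  where "real_linear g" "g (diagI e n) = 1" "\<forall>x\<in>C n. 0 \<le> g x" "g a < 0"
proof (rule cone_separation[OF vector_space_mscale, of "{A. trunc n A \<in> C n}" "diagI e n" a])
  fix A B :: "nat \<Rightarrow> nat \<Rightarrow> 'z"
  show "A + B \<in> {A. trunc n A \<in> C n}" if "A \<in> {A. trunc n A \<in> C n}" "B \<in> {A. trunc n A \<in> C n}"
    using that n by (simp add: trunc_add C_add)
  show "mscale sc (complex_of_real t) A \<in> {A. trunc n A \<in> C n}"
    if "A \<in> {A. trunc n A \<in> C n}" "0 \<le> t" for t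
    using that n by (simp add: trunc_scale C_scale)
  show "\<exists>t>0. mscale sc (complex_of_real t) (diagI e n) + A \<in> {A. trunc n A \<in> C n}"
    using C_unit[OF n trunc_in_mats[of n A]] by (simp add: trunc_add trunc_scale trunc_diagI)
  show "A \<in> {A. trunc n A \<in> C n}"
    if "\<And>t. 0 < t \<Longrightarrow> mscale sc (complex_of_real t) (diagI e n) + A \<in> {A. trunc n A \<in> C n}"
    using that C_arch[OF n trunc_in_mats[of n A]] by (simp add: trunc_add trunc_scale trunc_diagI)
  show "a \<notin> {A. trunc n A \<in> C n}"
    using a by (simp add: trunc_mats)
next
  fix g :: "(nat \<Rightarrow> nat \<Rightarrow> 'z) \<Rightarrow> real"
  assume g: "\<And>x y. g (x + y) = g x + g y" "\<And>r x. g (mscale sc (complex_of_real r) x) = r * g x"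
    "g (diagI e n) = 1" "\<And>x. x \<in> {A. trunc n A \<in> C n} \<Longrightarrow> 0 \<le> g x" "g a < 0"
  have "0 \<le> g x" if "x \<in> C n" for x
    using that C_mats[OF n that] by (intro g(4)) (simp add: trunc_mats)
  then have "\<forall>x\<in>C n. 0 \<le> g x" by (rule ballI)
  moreover have "real_linear g" unfolding real_linear_def using g(1,2) by simp
  ultimately show thesis using that g(3,5) by simp
qed

text \<open>The quadratic form of the \<open>k\<close>-th amplification of \<open>\<phi>\<close> at
  \<open>A\<close>, evaluated at a \<open>k\<close>-tuple \<open>\<xi>\<close> of vectors in complex
  \<open>n\<close>-space. The amplified matrix is accretive iff its real part is nonnegative for all
  \<open>\<xi>\<close>.\<close>

definition form :: "('z \<Rightarrow> nat \<Rightarrow> nat \<Rightarrow> complex) \<Rightarrow> nat \<Rightarrow> nat \<Rightarrow> (nat \<Rightarrow> nat \<Rightarrow> 'z)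
    \<Rightarrow> (nat \<Rightarrow> nat \<Rightarrow> complex) \<Rightarrow> complex" where
  "form \<phi> n k A \<xi> = (\<Sum>p<k. \<Sum>q<k. sform n (\<phi> (A p q)) (\<xi> q) (\<xi> p))"

definition real_cp :: "nat \<Rightarrow> ('z \<Rightarrow> nat \<Rightarrow> nat \<Rightarrow> complex) \<Rightarrow> bool" where
  "real_cp n \<phi> \<longleftrightarrow> (\<forall>z w i j. \<phi> (z + w) i j = \<phi> z i j + \<phi> w i j)
     \<and> (\<forall>c z i j. \<phi> (sc c z) i j = c * \<phi> z i j)
     \<and> (\<forall>k\<ge>1. \<forall>A\<in>C k. \<forall>\<xi>. 0 \<le> Re (form \<phi> n k A \<xi>))"

definition unital :: "nat \<Rightarrow> ('z \<Rightarrow> nat \<Rightarrow> nat \<Rightarrow> complex) \<Rightarrow> bool" where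
  "unital n \<phi> \<longleftrightarrow> (\<forall>i<n. \<forall>j<n. \<phi> e i j = (if i = j then 1 else 0))"

lemma form_cong: "(\<And>p i. p < k \<Longrightarrow> i < n \<Longrightarrow> \<xi> p i = \<eta> p i) \<Longrightarrow> form \<phi> n k A \<xi> = form \<phi> n k A \<eta>"
  unfolding form_def by (intro sum.cong refl sform_cong) auto

section \<open>From a functional on \<open>M_n(Z)\<close> to a map into \<open>M_n\<close>\<close>

context
  fixes h :: "(nat \<Rightarrow> nat \<Rightarrow> 'z) \<Rightarrow> real"
  assumes h: "real_linear h"
begin

lemmas h_add = real_linear_add[OF h]
lemmas h_scale = real_linear_scale[OF h]

text \<open>The complexification \<open>f A = h A - \<i> h (\<i> A)\<close> of the real functional \<open>h\<close> on \<open>M\<^sub>n(Z)\<close>,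
  read as a map from \<open>Z\<close> to \<open>M\<^sub>n\<close>.\<close>
definition fmap :: "'z \<Rightarrow> nat \<Rightarrow> nat \<Rightarrow> complex" where
  "fmap z i j = Complex (h (single i j z)) (- h (single i j (sc \<i> z)))"

lemma h_zero: "h 0 = 0"
  using h_add[of 0 0] by simp

lemma h_sum: "h (\<Sum>i\<in>S. f i) = (\<Sum>i\<in>S. h (f i))"
  by (induction S rule: infinite_finite_induct) (simp_all only: sum.infinite sum.empty sum.insert h_add h_zero simp_thms)

lemma fmap_add: "fmap (z + w) i j = fmap z i j + fmap w i j"
proof -
  have "single i j (z + w) = single i j z + single i j w" for z w :: 'z
    by (auto simp: single_def fun_eq_iff)
  then show ?thesis by (simp add: fmap_def h_add scale_right_distrib complex_eq_iff)
qed

lemma fmap_scale: "fmap (sc c z) i j = c * fmap z i j"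
proof -
  have *: "h (single i j (sc (complex_of_real r) z)) = r * h (single i j z)" for r z
  proof -
    have "single i j (sc (complex_of_real r) z) = mscale sc (complex_of_real r) (single i j z)"
      by (auto simp: single_def mscale_def fun_eq_iff)
    then show ?thesis by (simp only: h_scale)
  qed
  have real: "fmap (sc (complex_of_real r) z) i j = complex_of_real r * fmap z i j" for r z
    using *[of r z] *[of r "sc \<i> z"] by (simp add: fmap_def complex_eq_iff mult.commute)
  have imag: "fmap (sc \<i> z) i j = \<i> * fmap z i j" for z
    using *[of "-1" z] by (simp add: fmap_def complex_eq_iff)
  have "sc c z = sc (complex_of_real (Re c)) z + sc \<i> (sc (complex_of_real (Im c)) z)"
    by (subst complex_eq[of c]) (simp add: scale_left_distrib)
  then have "fmap (sc c z) i j = complex_of_real (Re c) * fmap z i j + \<i> * (complex_of_real (Im c) * fmap z i j)"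
    by (simp only: fmap_add imag real)
  also have "\<dots> = c * fmap z i j"
    by (subst (3) complex_eq[of c]) (simp add: algebra_simps)
  finally show ?thesis .
qed

lemma fmap_sum: "fmap (\<Sum>k\<in>S. f k) i j = (\<Sum>k\<in>S. fmap (f k) i j)"
proof (induction S rule: infinite_finite_induct)
  case (insert k S)
  then show ?case by (simp add: fmap_add)
qed (use fmap_scale[of 0 0 i j] in simp_all)

lemma Re_sum_fmap: "Re (\<Sum>i<n. \<Sum>j<n. fmap (A i j) i j) = h (trunc n A)"
  by (simp add: trunc_eq_sum_single h_sum fmap_def)

text \<open>A Choi-type correspondence. The tuple \<open>\<xi>\<close> is read as a \<open>k\<close>
  by \<open>n\<close> scalar matrix; linearity moves its coefficients inside \<open>fmap\<close>,
  and reordering the sums collects the entries of \<open>\<xi>^* A \<xi>\<close>. Since the cones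
  are stable under such congruences, positivity of \<open>h\<close> on the single cone
  \<open>C n\<close> gives positivity at every level \<open>k\<close>.\<close>

lemma Re_form_fmap: "Re (form fmap n k A \<xi>) = h (congr sc k n \<xi> A)"
proof -
  have "form fmap n k A \<xi> = (\<Sum>p<k. \<Sum>q<k. \<Sum>i<n. \<Sum>j<n. fmap (sc (cnj (\<xi> p i) * \<xi> q j) (A p q)) i j)"
    by (simp add: form_def sform_def fmap_scale mult_ac)
  also have "\<dots> = (\<Sum>p<k. \<Sum>i<n. \<Sum>q<k. \<Sum>j<n. fmap (sc (cnj (\<xi> p i) * \<xi> q j) (A p q)) i j)"
    by (intro sum.cong refl sum.swap)
  also have "\<dots> = (\<Sum>i<n. \<Sum>p<k. \<Sum>j<n. \<Sum>q<k. fmap (sc (cnj (\<xi> p i) * \<xi> q j) (A p q)) i j)"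
    by (subst sum.swap) (intro sum.cong refl sum.swap)
  also have "\<dots> = (\<Sum>i<n. \<Sum>j<n. \<Sum>p<k. \<Sum>q<k. fmap (sc (cnj (\<xi> p i) * \<xi> q j) (A p q)) i j)"
    by (intro sum.cong refl sum.swap)
  also have "\<dots> = (\<Sum>i<n. \<Sum>j<n. fmap (congr sc k n \<xi> A i j) i j)"
    by (simp add: congr_def fmap_sum)
  finally have "Re (form fmap n k A \<xi>) = h (trunc n (congr sc k n \<xi> A))"
    by (simp only: Re_sum_fmap)
  also have "trunc n (congr sc k n \<xi> A) = congr sc k n \<xi> A"
    by (rule trunc_mats) (auto simp: mats_def congr_def)
  finally show ?thesis .
qed

end

section \<open>Unital maps that separate\<close>

lemma real_cp_scale: "real_cp n \<phi> \<Longrightarrow> \<phi> (sc c z) i j = c * \<phi> z i j"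
  and real_cp_add: "real_cp n \<phi> \<Longrightarrow> \<phi> (z + w) i j = \<phi> z i j + \<phi> w i j"
  and real_cp_form: "real_cp n \<phi> \<Longrightarrow> 1 \<le> k \<Longrightarrow> A \<in> C k \<Longrightarrow> 0 \<le> Re (form \<phi> n k A \<xi>)"
  by (simp_all add: real_cp_def)

lemma form_sgl: "form \<phi> n 1 (sgl z) \<xi> = sform n (\<phi> z) (\<xi> 0) (\<xi> 0)"
  by (simp add: form_def sgl_def)

lemma real_cp_Im_e:
  assumes "real_cp n \<phi>"
  shows "Im (sform n (\<phi> e) x x) = 0"
proof -
  have scale: "sform n (\<phi> (sc c e)) x x = c * sform n (\<phi> e) x x" for c
    using assms by (simp add: sform_def real_cp_scale sum_distrib_left mult_ac)
  from C_unit_imaginary show ?thesis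
    using real_cp_form[OF assms, of 1 "sgl (sc \<i> e)" "\<lambda>_. x"] real_cp_form[OF assms, of 1 "sgl (sc (- \<i>) e)" "\<lambda>_. x"]
    unfolding form_sgl scale by simp
qed

text \<open>Averaging \<open>g\<close> over the matrix units and adding a small multiple makes the induced map
  positive definite at \<open>e\<close>.\<close>
lemma perturbed_functional:
  assumes n: "1 \<le> n" and a: "a \<in> mats n" "a \<notin> C n"
  obtains h :: "(nat \<Rightarrow> nat \<Rightarrow> 'z) \<Rightarrow> real"
  where "real_linear h" "\<forall>x\<in>C n. 0 \<le> h x" "h a < 0"
    "\<forall>x i. i < n \<longrightarrow> x i \<noteq> 0 \<longrightarrow> 0 < h (congr sc 1 n (\<lambda>_. x) (sgl e))"
proof -
  obtain g :: "(nat \<Rightarrow> nat \<Rightarrow> 'z) \<Rightarrow> real"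
    where g_lin: "real_linear g" and g_unit: "g (diagI e n) = 1"
      and g_C: "\<forall>x\<in>C n. 0 \<le> g x" and g_a: "g a < 0"
    by (rule C_separation[OF n a])
  note g = real_linear_add[OF g_lin] real_linear_scale[OF g_lin] g_unit bspec[OF g_C] g_a
  \<comment> \<open>\<open>s A\<close> is \<open>g\<close> at the diagonal matrix all of whose
    diagonal entries are the trace of \<open>A\<close>. On a congruence of \<open>e\<close> by a row
    \<open>x\<close> the trace is the squared length of \<open>x\<close> times \<open>e\<close>, so
    \<open>g (diagI e n) = 1\<close> makes \<open>s\<close> equal to that squared length.\<close>
  define s where "s A = (\<Sum>i<n. \<Sum>l<n. g (single l l (A i i)))" for A :: "nat \<Rightarrow> nat \<Rightarrow> 'z"
  have s_add: "s (A + B) = s A + s B" for A B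
  proof -
    have "single l l (z + w) = single l l z + single l l w" for l and z w :: 'z
      by (auto simp: single_def fun_eq_iff)
    then show ?thesis by (simp add: s_def g(1) sum.distrib)
  qed
  have s_scale: "s (mscale sc (complex_of_real r) A) = r * s A" for r A
  proof -
    have *: "single l l (mscale sc (complex_of_real r) A i i) = mscale sc (complex_of_real r) (single l l (A i i))" for i l
      by (auto simp: single_def mscale_def fun_eq_iff)
    show ?thesis by (simp only: s_def * g(2) sum_distrib_left)
  qed
  have s_nonneg: "0 \<le> s A" if "A \<in> C n" for A
    unfolding s_def
  proof (intro sum_nonneg)
    fix i l assume il: "i \<in> {..<n}" "l \<in> {..<n}"
    \<comment> \<open>A matrix unit: the congruence by it moves the diagonal entry
      \<open>A i i\<close> to position \<open>(l, l)\<close> and deletes everything else.\<close>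
    define X :: "nat \<Rightarrow> nat \<Rightarrow> complex" where "X p q = (if p = i \<and> q = l then 1 else 0)" for p q
    have "single l l (A i i) = congr sc n n X A"
    proof (intro ext)
      fix p q
      have "(\<Sum>i'<n. \<Sum>j<n. sc (cnj (X i' p) * X j q) (A i' j))
          = (\<Sum>i'<n. if i' = i then (\<Sum>j<n. if j = i then single l l (A i i) p q else 0) else 0)"
      proof (intro sum.cong refl)
        fix i'
        have entry: "sc (cnj (X i' p) * X j q) (A i' j) = (if i' = i then (if j = i then single l l (A i i) p q else 0) else 0)" for j
          by (simp add: X_def single_def)
        then show "(\<Sum>j<n. sc (cnj (X i' p) * X j q) (A i' j))
            = (if i' = i then (\<Sum>j<n. if j = i then single l l (A i i) p q else 0) else 0)"
          unfolding entry by (cases "i' = i") simp_all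
      qed
      also have "\<dots> = single l l (A i i) p q"
        using il by simp
      finally show "single l l (A i i) p q = congr sc n n X A p q"
        using il by (auto simp: congr_def single_def)
    qed
    then show "0 \<le> g (single l l (A i i))"
      using C_congr[OF n n that] by (intro g(4)) simp
  qed
  \<comment> \<open>With this size the perturbation adds at most \<open>- g a / 2\<close> at
    \<open>a\<close>, so half of the negative value survives. The summand 1 keeps the denominator
    positive when \<open>s a = 0\<close>.\<close>
  define \<epsilon> where "\<epsilon> = - g a / (2 * (\<bar>s a\<bar> + 1))"
  have \<epsilon>: "\<epsilon> > 0" using g(5) by (simp add: \<epsilon>_def divide_neg_pos)
  define h where "h A = g A + \<epsilon> * s A" for A
  show ?thesis
  proof
    show "real_linear h"
      by (simp add: real_linear_def h_def g(1,2) s_add s_scale algebra_simps)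
    show "\<forall>x\<in>C n. 0 \<le> h x"
      using g(4) s_nonneg \<epsilon> by (simp add: h_def)
    have "\<epsilon> * s a \<le> \<epsilon> * (\<bar>s a\<bar> + 1)" using \<epsilon> by (intro mult_left_mono) auto
    also have "\<dots> = - g a / 2" by (simp add: \<epsilon>_def field_simps add_nonneg_eq_0_iff)
    finally show "h a < 0" using g(5) by (simp add: h_def)
    show "\<forall>x i. i < n \<longrightarrow> x i \<noteq> 0 \<longrightarrow> 0 < h (congr sc 1 n (\<lambda>_. x) (sgl e))"
    proof (intro allI impI)
      fix x :: "nat \<Rightarrow> complex" and i
      assume i: "i < n" "x i \<noteq> 0"
      let ?M = "congr sc 1 n (\<lambda>_. x) (sgl e)"
      \<comment> \<open>\<open>e\<close> itself is accretive: the order unit property at the zero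
        matrix gives a positive multiple of \<open>e\<close>, which is then rescaled.\<close>
      obtain t where "t > 0" "mscale sc (complex_of_real t) (diagI e 1) + 0 \<in> C 1"
        using C_unit[of 1 0] by (auto simp: mats_def)
      then have "mscale sc (complex_of_real (1 / t)) (mscale sc (complex_of_real t) (diagI e 1)) \<in> C 1"
        by (intro C_scale[of 1 "mscale sc (complex_of_real t) (diagI e 1)"]) auto
      moreover have "mscale sc (complex_of_real (1 / t)) (mscale sc (complex_of_real t) (diagI e 1)) = sgl e"
        using \<open>t > 0\<close> by (auto simp: mscale_mscale fun_eq_iff) (auto simp: mscale_def diagI_def sgl_def)
      ultimately have "?M \<in> C n" using C_congr[of 1 n "sgl e"] n by simp
      then have "0 \<le> g ?M" by (rule g(4))
      moreover have "s ?M = (\<Sum>i<n. (cmod (x i))\<^sup>2)"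
      proof -
        have g_sum: "(\<Sum>l\<in>S. g (f l)) = g (\<Sum>l\<in>S. f l)" for S and f :: "nat \<Rightarrow> nat \<Rightarrow> nat \<Rightarrow> 'z"
          by (rule h_sum[OF g_lin, symmetric])
        have diag: "(\<Sum>l<n. single l l e) = diagI e n"
        proof -
          have "trunc n (diagI e n) = (\<Sum>i<n. \<Sum>j<n. if j = i then single i i e else 0)"
            unfolding trunc_eq_sum_single by (intro sum.cong refl) (auto simp: diagI_def single_def fun_eq_iff)
          then show ?thesis by (simp add: trunc_diagI)
        qed
        have "s ?M = (\<Sum>i<n. \<Sum>l<n. (cmod (x i))\<^sup>2 * g (single l l e))"
          unfolding s_def
        proof (intro sum.cong refl)
          fix i l assume "i \<in> {..<n}" "l \<in> {..<n}"
          then have "?M i i = sc (complex_of_real ((cmod (x i))\<^sup>2)) e"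
            by (simp add: congr_def sgl_def complex_norm_square mult.commute del: of_real_power)
          then have "single l l (?M i i) = mscale sc (complex_of_real ((cmod (x i))\<^sup>2)) (single l l e)"
            by (auto simp: single_def mscale_def fun_eq_iff)
          then show "g (single l l (?M i i)) = (cmod (x i))\<^sup>2 * g (single l l e)"
            by (simp only: g(2))
        qed
        also have "\<dots> = (\<Sum>i<n. (cmod (x i))\<^sup>2)"
          by (simp only: g_sum diag g(3) mult_1_right flip: sum_distrib_left)
        finally show ?thesis .
      qed
      moreover have "0 < (\<Sum>i<n. (cmod (x i))\<^sup>2)"
        using i by (intro sum_pos2[of _ i]) auto
      ultimately show "0 < h ?M" using \<epsilon> by (simp add: h_def add_nonneg_pos)
    qed
  qed
qed

lemma form_change_basis:
  "form (\<lambda>z k l. sform n (\<phi> z) (b l) (b k)) n k A \<xi> = form \<phi> n k A (\<lambda>p i. \<Sum>l<n. \<xi> p l * b l i)"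
  unfolding form_def sform_change_basis[symmetric] by (simp add: sform_def)

text \<open>Positive definiteness of \<open>\<psi> e\<close> permits a basis orthonormal for its
  form. In this basis the map is unital, and since the change of basis is invertible, the tuple that
  witnesses \<open>h a < 0\<close> can be rewritten in the new coordinates.\<close>

lemma unital_separation:
  assumes n: "1 \<le> n" and a: "a \<in> mats n" "a \<notin> C n"
  obtains \<phi> \<xi> where "real_cp n \<phi>" "unital n \<phi>" "Re (form \<phi> n n a \<xi>) < 0"
proof -
  obtain h :: "(nat \<Rightarrow> nat \<Rightarrow> 'z) \<Rightarrow> real"
    where h: "real_linear h" "\<forall>x\<in>C n. 0 \<le> h x" "h a < 0"
      "\<forall>x i. i < n \<longrightarrow> x i \<noteq> 0 \<longrightarrow> 0 < h (congr sc 1 n (\<lambda>_. x) (sgl e))"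
    by (rule perturbed_functional[OF n a])
  define \<psi> where "\<psi> = fmap h"
  note Re_form = Re_form_fmap[OF h(1), folded \<psi>_def]
  have \<psi>: "real_cp n \<psi>"
    unfolding real_cp_def Re_form using C_congr n h(2)
    by (auto simp: \<psi>_def fmap_add[OF h(1)] fmap_scale[OF h(1)])
  have pos: "0 < Re (sform n (\<psi> e) x x)" if "i < n" "x i \<noteq> 0" for x i
    using spec[OF spec[OF h(4), of x], of i] that Re_form[of n 1 "sgl e" "\<lambda>_. x"]
    by (simp only: form_sgl simp_thms)
  obtain b where orth: "\<forall>k<n. \<forall>l<n. sform n (\<psi> e) (b l) (b k) = (if k = l then 1 else 0)"
    and span: "\<forall>v. \<exists>c. \<forall>i<n. v i = (\<Sum>k<n. c k * b k i)"
    by (rule sform_orthonormal_basis[OF real_cp_Im_e[OF \<psi>] pos])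
  define \<phi> where "\<phi> z k l = sform n (\<psi> z) (b l) (b k)" for z k l
  have form_\<phi>: "form \<phi> n k A \<xi> = form \<psi> n k A (\<lambda>p i. \<Sum>l<n. \<xi> p l * b l i)" for k A \<xi>
    unfolding \<phi>_def by (rule form_change_basis)
  from choice[OF span] obtain c where c: "\<forall>v. \<forall>i<n. v i = (\<Sum>k<n. c v k * b k i)"
    by (rule exE)
  \<comment> \<open>The coordinates of the \<open>p\<close>-th standard basis vector with respect to
    \<open>b\<close>. The tuple of standard basis vectors is the identity matrix, whose congruence
    returns \<open>a\<close>.\<close>
  define \<xi> where "\<xi> p = c (\<lambda>i. if p = i then 1 else 0)" for p :: nat
  have \<xi>: "(\<Sum>k<n. \<xi> p k * b k i) = (if p = i then 1 else 0)" if "i < n" for p i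
    using spec[OF c, of "\<lambda>i. if p = i then 1 else 0"] that by (simp add: \<xi>_def)
  show ?thesis
  proof
    show "real_cp n \<phi>"
      unfolding real_cp_def form_\<phi>
      using real_cp_form[OF \<psi>]
      by (simp add: \<phi>_def sform_def real_cp_add[OF \<psi>] real_cp_scale[OF \<psi>] distrib_right
          sum.distrib sum_distrib_left mult.assoc)
    show "unital n \<phi>" by (simp add: unital_def \<phi>_def orth)
    have "form \<phi> n n a \<xi> = form \<psi> n n a (\<lambda>p i. if p = i then 1 else 0)"
      unfolding form_\<phi> by (rule form_cong) (simp add: \<xi>)
    also have "Re \<dots> = h (congr sc n n (\<lambda>p i. if p = i then 1 else 0) a)"
      by (rule Re_form)
    also have "congr sc n n (\<lambda>p i. if p = i then 1 else 0) a = a"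
    proof (intro ext)
      fix p q
      have "(\<Sum>i<n. \<Sum>j<n. sc (cnj (if i = p then 1 else 0) * (if j = q then 1 else 0)) (a i j))
          = (\<Sum>i<n. if i = p then (\<Sum>j<n. if j = q then a p q else 0) else 0)"
      proof (intro sum.cong refl)
        fix i
        have entry: "sc (cnj (if i = p then 1 else 0) * (if j = q then 1 else 0)) (a i j)
            = (if i = p then (if j = q then a p q else 0) else 0)" for j
          by simp
        show "(\<Sum>j<n. sc (cnj (if i = p then 1 else 0) * (if j = q then 1 else 0)) (a i j))
            = (if i = p then (\<Sum>j<n. if j = q then a p q else 0) else 0)"
          unfolding entry by (cases "i = p") simp_all
      qed
      also have "\<dots> = (if p < n \<and> q < n then a p q else 0)" by simp
      finally show "congr sc n n (\<lambda>p i. if p = i then 1 else 0) a p q = a p q"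
        using a(1) by (auto simp: congr_def mats_def)
    qed
    finally show "Re (form \<phi> n n a \<xi>) < 0" using h(3) by simp
  qed
qed

end

lemma infsum_sum_finite:
  fixes f :: "'a \<Rightarrow> 'b \<Rightarrow> complex"
  assumes "\<And>k. k \<in> K \<Longrightarrow> f k summable_on A"
  shows "(\<lambda>x. \<Sum>k\<in>K. f k x) summable_on A \<and> infsum (\<lambda>x. \<Sum>k\<in>K. f k x) A = (\<Sum>k\<in>K. infsum (f k) A)"
  using assms
proof (induction K rule: infinite_finite_induct)
  case (insert k K)
  then show ?case by (simp add: infsum_add summable_on_add)
qed simp_all

lemma sum_lessThan_add: "(\<Sum>i<m + n. f i) = (\<Sum>i<m. f i) + (\<Sum>i<n. f (m + i))"
  for f :: "nat \<Rightarrow> 'a::comm_monoid_add"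
  by (induction n) (simp_all add: add.assoc)

section \<open>Corner matrices and a uniform bound for the blocks\<close>

context accretive_space
begin

text \<open>Stated for an arbitrary family of linear functionals because it is used twice: with the
  forms of a single block in \<open>block_bound\<close>, and with inner products in the direct sum
  in \<open>form_scaled_unit_minus_corner2\<close>.\<close>

lemma sum_scaled_unit_minus_corner2:
  assumes add: "\<And>p q z w. h p q (z + w) = h p q z + h p q w"
    and scale: "\<And>p q c z. h p q (sc c z) = c * h p q z"
  shows "(\<Sum>p<2*n. \<Sum>q<2*n. h p q ((mscale sc t (diagI e (2 * n)) - corner2 n z) p q))
    = t * (\<Sum>p<2*n. h p p e) - 2 * (\<Sum>p<n. \<Sum>q<n. h p (n + q) (z p q))"
proof -
  have zero: "h p q 0 = 0" for p q
    using scale[of p q 0 0] by simp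
  have diff: "h p q (z - w) = h p q z - h p q w" for p q z w
    using add[of p q "z - w" w] by simp
  have entry: "h p q ((mscale sc t (diagI e (2 * n)) - corner2 n z) p q)
      = (if q = p then t * h p p e else 0) - (if p < n \<and> n \<le> q then 2 * h p q (z p (q - n)) else 0)"
    if "p < 2 * n" "q < 2 * n" for p q
    using that by (auto simp: diff zero scale add mscale_def diagI_def corner2_def)
  have "(\<Sum>p<2*n. \<Sum>q<2*n. h p q ((mscale sc t (diagI e (2 * n)) - corner2 n z) p q))
      = (\<Sum>p<2*n. \<Sum>q<2*n. if q = p then t * h p p e else 0)
        - (\<Sum>p<2*n. \<Sum>q<2*n. if p < n \<and> n \<le> q then 2 * h p q (z p (q - n)) else 0)"
    unfolding sum_subtractf[symmetric] by (intro sum.cong refl entry) auto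
  also have "(\<Sum>p<2*n. \<Sum>q<2*n. if q = p then t * h p p e else 0) = t * (\<Sum>p<2*n. h p p e)"
    by (simp add: sum_distrib_left)
  also have "(\<Sum>p<2*n. \<Sum>q<2*n. if p < n \<and> n \<le> q then 2 * h p q (z p (q - n)) else 0)
      = 2 * (\<Sum>p<n. \<Sum>q<n. h p (n + q) (z p q))"
    unfolding mult_2[of n] sum_lessThan_add by (simp add: sum_distrib_left)
  finally show ?thesis .
qed

text \<open>Entries of \<open>\<phi>\<close> with an index beyond \<open>n\<close> are constrained
  neither by positivity nor by unitality, so the same map into \<open>M_n\<close> may occur many
  times. Repetitions change neither the order nor the norm of a direct sum.\<close>

definition blocks :: "(nat \<times> ('z \<Rightarrow> nat \<Rightarrow> nat \<Rightarrow> complex)) set" where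
  "blocks = {(n, \<phi>). 1 \<le> n \<and> real_cp n \<phi> \<and> unital n \<phi>}"

lemma corner2_unit:
  assumes "1 \<le> n"
  obtains t where "t > 0" "mscale sc (complex_of_real t) (diagI e (2 * n)) - corner2 n z \<in> C (2 * n)"
proof -
  have "- corner2 n z \<in> mats (2 * n)"
    by (auto simp: mats_def corner2_def)
  from C_unit[OF _ this] assms that show ?thesis by auto
qed

text \<open>The number \<open>t\<close> comes from the order unit applied to the corner matrix of
  \<open>z\<close>, before any block is chosen. Positivity of a unital map on this one 2 by 2 matrix
  already bounds the norm of its value at \<open>z\<close> by \<open>t\<close>.\<close>

lemma block_bound:
  obtains t where "t > 0" "\<forall>(n, \<phi>) \<in> blocks. \<forall>v.
    (\<Sum>i<n. (cmod (\<Sum>j<n. \<phi> z i j * v j))\<^sup>2) \<le> t\<^sup>2 * (\<Sum>j<n. (cmod (v j))\<^sup>2)"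
proof -
  obtain t where t: "t > 0" "mscale sc (complex_of_real t) (diagI e (2 * 1)) - corner2 1 (sgl z) \<in> C (2 * 1)"
    using corner2_unit[of 1 "sgl z"] by auto
  show ?thesis
  proof (rule that[OF t(1)], clarify)
    fix n \<phi> and v :: "nat \<Rightarrow> complex"
    assume "(n, \<phi>) \<in> blocks"
    then have cp: "real_cp n \<phi>" and un: "unital n \<phi>" by (auto simp: blocks_def)
    define w where "w i = (\<Sum>j<n. \<phi> z i j * v j)" for i
    \<comment> \<open>For fixed second component \<open>v\<close>, the form is smallest when the
      first component is \<open>w / t\<close>; its value there is
      \<open>(t\<^sup>2 * N v - N w) / t\<close>.\<close>
    define \<xi> where "\<xi> p = (if p = 0 then (\<lambda>i. complex_of_real (1 / t) * w i) else v)" for p :: nat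
    define N where "N x = (\<Sum>i<n. (cmod (x i))\<^sup>2)" for x :: "nat \<Rightarrow> complex"
    have self: "sform n (\<phi> e) x x = of_real (N x)" for x
    proof -
      have "sform n (\<phi> e) x x = (\<Sum>i<n. \<Sum>j<n. if j = i then x i * cnj (x i) else 0)"
        unfolding sform_def using un by (intro sum.cong refl) (auto simp: unital_def)
      then show ?thesis by (simp add: N_def complex_norm_square del: of_real_power)
    qed
    have N_scale: "N (\<lambda>i. complex_of_real r * x i) = r\<^sup>2 * N x" for r x
      by (simp add: N_def norm_mult power_mult_distrib sum_distrib_left)
    have cross: "sform n (\<phi> z) v (\<lambda>i. complex_of_real (1 / t) * w i) = of_real (N w / t)"
    proof -
      have "sform n (\<phi> z) v w = (\<Sum>i<n. w i * cnj (w i))"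
        by (simp add: sform_def w_def sum_distrib_right)
      then show ?thesis
        by (simp only: sform_scale_right) (simp add: N_def complex_norm_square sum_divide_distrib flip: of_real_power)
    qed
    have two: "(\<Sum>p<2*1. f p) = f 0 + f 1" for f :: "nat \<Rightarrow> complex"
      by (simp add: numeral_2_eq_2)
    let ?A = "mscale sc (complex_of_real t) (diagI e (2 * 1)) - corner2 1 (sgl z)"
    have "form \<phi> n (2 * 1) ?A \<xi>
        = of_real t * (\<Sum>p<2*1. sform n (\<phi> e) (\<xi> p) (\<xi> p))
          - 2 * (\<Sum>p<1. \<Sum>q<1. sform n (\<phi> (sgl z p q)) (\<xi> (1 + q)) (\<xi> p))"
      unfolding form_def
      by (rule sum_scaled_unit_minus_corner2)
        (simp_all add: sform_def real_cp_add[OF cp] real_cp_scale[OF cp] distrib_right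
          sum.distrib sum_distrib_left mult.assoc)
    also have "(\<Sum>p<2*1. sform n (\<phi> e) (\<xi> p) (\<xi> p)) = of_real (N (\<xi> 0)) + of_real (N v)"
      unfolding two self by (simp add: \<xi>_def)
    also have "(\<Sum>p<1. \<Sum>q<1. sform n (\<phi> (sgl z p q)) (\<xi> (1 + q)) (\<xi> p)) = of_real (N w / t)"
      using cross by (simp add: sgl_def \<xi>_def)
    also have "N (\<xi> 0) = N w / t\<^sup>2"
      unfolding \<xi>_def by (simp only: simp_thms if_True N_scale) (simp add: power_divide)
    also have "of_real t * (of_real (N w / t\<^sup>2) + of_real (N v)) - 2 * of_real (N w / t)
        = complex_of_real (t * (N w / t\<^sup>2 + N v) - 2 * (N w / t))"
      by simp
    finally have "Re (form \<phi> n (2 * 1) ?A \<xi>) = t * (N w / t\<^sup>2 + N v) - 2 * (N w / t)"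
      by (simp only: Re_complex_of_real)
    moreover have "0 \<le> Re (form \<phi> n (2 * 1) ?A \<xi>)"
      by (rule real_cp_form[OF cp _ t(2)]) simp
    ultimately have "0 \<le> t * (N w / t\<^sup>2 + N v) - 2 * (N w / t)" by (simp only:)
    also have "t * (N w / t\<^sup>2 + N v) - 2 * (N w / t) = (t\<^sup>2 * N v - N w) / t"
      using t(1) by (simp add: field_simps power2_eq_square)
    finally have "N w \<le> t\<^sup>2 * N v"
      using t(1) by (simp add: zero_le_divide_iff)
    then show "(\<Sum>i<n. (cmod (\<Sum>j<n. \<phi> z i j * v j))\<^sup>2) \<le> t\<^sup>2 * (\<Sum>j<n. (cmod (v j))\<^sup>2)"
      by (simp add: N_def w_def)
  qed
qed

end

subsection \<open>The direct sum\<close>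

text \<open>The Hilbert space has one basis vector per block and coordinate; \<open>code\<close> moves these pairs into
  the required index type.\<close>
locale direct_sum = accretive_space sc C e
  for sc :: "complex \<Rightarrow> 'z::ab_group_add \<Rightarrow> 'z" and C e +
  fixes code :: "(nat \<times> ('z \<Rightarrow> nat \<Rightarrow> nat \<Rightarrow> complex)) \<times> nat \<Rightarrow> 'i"
  assumes inj_code: "inj code"
begin

definition I :: "'i set" where
  "I = code ` Sigma blocks (\<lambda>b. {..<fst b})"

definition coord :: "('i \<Rightarrow> complex) \<Rightarrow> nat \<times> ('z \<Rightarrow> nat \<Rightarrow> nat \<Rightarrow> complex) \<Rightarrow> nat \<Rightarrow> complex" where
  "coord f b j = f (code (b, j))"

text \<open>The block-diagonal operator with the matrix \<open>\<phi> z\<close> in the block of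
  \<open>(n, \<phi>)\<close>. The value 0 off \<open>l2 I\<close> is the normalisation that
  \<open>bops\<close> prescribes.\<close>

definition op :: "'z \<Rightarrow> ('i \<Rightarrow> complex) \<Rightarrow> 'i \<Rightarrow> complex" where
  "op z f x = (if f \<in> l2 I \<and> x \<in> I
     then let (b, k) = inv code x in \<Sum>j<fst b. snd b z k j * coord f b j else 0)"

lemma op_outside: "f \<notin> l2 I \<Longrightarrow> op z f = 0"
  by (simp add: op_def fun_eq_iff)

lemma code_in_I: "code (b, k) \<in> I \<longleftrightarrow> b \<in> blocks \<and> k < fst b"
  by (auto simp: I_def image_iff inj_eq[OF inj_code])

lemma op_code:
  assumes "f \<in> l2 I" "b \<in> blocks" "k < fst b"
  shows "op z f (code (b, k)) = (\<Sum>j<fst b. snd b z k j * coord f b j)"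
  using assms by (simp add: op_def code_in_I inv_f_f[OF inj_code])

lemma I_cases:
  assumes "x \<in> I" obtains b k where "b \<in> blocks" "k < fst b" "x = code (b, k)"
  using assms by (auto simp: I_def)

lemma op_eqI:
  assumes "f \<in> l2 I" "\<And>x. x \<notin> I \<Longrightarrow> g x = 0"
    "\<And>b k. b \<in> blocks \<Longrightarrow> k < fst b \<Longrightarrow> (\<Sum>j<fst b. snd b z k j * coord f b j) = g (code (b, k))"
  shows "op z f = g"
proof
  fix x
  show "op z f x = g x"
  proof (cases "x \<in> I")
    case True
    then show ?thesis by (rule I_cases) (simp add: op_code assms)
  qed (simp add: op_def assms)
qed

lemma blocks_cp: "b \<in> blocks \<Longrightarrow> real_cp (fst b) (snd b)"
  and blocks_unital: "b \<in> blocks \<Longrightarrow> unital (fst b) (snd b)"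
  by (auto simp: blocks_def)

lemma op_add: "op (z + w) f = (\<lambda>x. op z f x + op w f x)"
proof (cases "f \<in> l2 I")
  case True
  then show ?thesis
    by (intro op_eqI) (auto simp: op_code real_cp_add[OF blocks_cp] distrib_right sum.distrib, simp add: op_def)
qed (simp add: op_outside zero_fun_def)

lemma op_scale: "op (sc c z) f = (\<lambda>x. c * op z f x)"
proof (cases "f \<in> l2 I")
  case True
  then show ?thesis
    by (intro op_eqI) (auto simp: op_code real_cp_scale[OF blocks_cp] sum_distrib_left mult.assoc, simp add: op_def)
qed (simp add: op_outside zero_fun_def)

lemma op_unit: "op e = idop I"
proof
  fix f
  show "op e f = idop I f"
  proof (cases "f \<in> l2 I")
    case True
    have "op e f = f"
    proof (rule op_eqI[OF True l2_outside[OF True]])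
      fix b k assume b: "b \<in> blocks" "k < fst b"
      have "(\<Sum>j<fst b. snd b e k j * coord f b j) = (\<Sum>j<fst b. if j = k then coord f b k else 0)"
        using blocks_unital[OF b(1)] b(2) by (intro sum.cong) (auto simp: unital_def)
      then show "(\<Sum>j<fst b. snd b e k j * coord f b j) = f (code (b, k))"
        using b(2) by (simp add: coord_def)
    qed
    then show ?thesis using True by (simp add: idop_def)
  qed (simp add: op_outside idop_def)
qed

lemma op_lincomb:
  assumes "f \<in> l2 I" "g \<in> l2 I"
  shows "op z (\<lambda>x. a * f x + b * g x) = (\<lambda>x. a * op z f x + b * op z g x)"
proof (rule op_eqI)
  show "(\<lambda>x. a * f x + b * g x) \<in> l2 I" by (rule l2_lincomb[OF assms])
  show "a * op z f x + b * op z g x = 0" if "x \<notin> I" for x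
    using that by (simp add: op_def)
  show "(\<Sum>j<fst b'. snd b' z k j * coord (\<lambda>x. a * f x + b * g x) b' j)
      = a * op z f (code (b', k)) + b * op z g (code (b', k))" if "b' \<in> blocks" "k < fst b'" for b' k
    using that by (simp add: op_code assms coord_def algebra_simps sum.distrib sum_distrib_left)
qed

lemma op_bounded:
  obtains t where "\<forall>f\<in>l2 I. op z f \<in> l2 I \<and> l2_norm I (op z f) \<le> t * l2_norm I f"
proof -
  obtain t where t: "t > 0" and bound': "\<forall>(n, \<phi>) \<in> blocks. \<forall>v.
    (\<Sum>i<n. (cmod (\<Sum>j<n. \<phi> z i j * v j))\<^sup>2) \<le> t\<^sup>2 * (\<Sum>j<n. (cmod (v j))\<^sup>2)"
    by (rule block_bound)
  have bound: "(\<Sum>i<fst b. (cmod (\<Sum>j<fst b. snd b z i j * v j))\<^sup>2) \<le> t\<^sup>2 * (\<Sum>j<fst b. (cmod (v j))\<^sup>2)"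
    if "b \<in> blocks" for b v
    using bspec[OF bound' that] by (simp only: case_prod_unfold)
  have partial: "(\<Sum>x\<in>F. (cmod (op z f x))\<^sup>2) \<le> (t * l2_norm I f)\<^sup>2"
    if f: "f \<in> l2 I" and F: "finite F" "F \<subseteq> I" for f F
  proof -
    \<comment> \<open>A finite set \<open>F\<close> of coordinates may cut through blocks. It is
      enlarged to all coordinates of the finitely many blocks that it meets, where the blockwise
      bound applies.\<close>
    define B where "B = (fst \<circ> inv code) ` F"
    define S where "S = Sigma B (\<lambda>b. {..<fst b})"
    have B: "finite B" "B \<subseteq> blocks"
      using F by (auto simp: B_def I_def inv_f_f[OF inj_code])
    have FS: "F \<subseteq> code ` S"
    proof
      fix x assume x: "x \<in> F"
      then obtain b k where bk: "b \<in> blocks" "k < fst b" "x = code (b, k)"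
        using F(2) I_cases by blast
      then have "b \<in> B" using x by (force simp: B_def inv_f_f[OF inj_code])
      with bk show "x \<in> code ` S" by (auto simp: S_def)
    qed
    have SI: "code ` S \<subseteq> I" using B(2) by (auto simp: S_def I_def)
    have fS: "finite (code ` S)" using B(1) by (auto simp: S_def)
    have split: "(\<Sum>x\<in>code ` S. h x) = (\<Sum>b\<in>B. \<Sum>k<fst b. h (code (b, k)))" for h :: "'i \<Rightarrow> real"
      using B(1) by (simp add: S_def sum.reindex[OF inj_on_subset[OF inj_code subset_UNIV]] sum.Sigma case_prod_unfold)
    have "(\<Sum>x\<in>F. (cmod (op z f x))\<^sup>2) \<le> (\<Sum>x\<in>code ` S. (cmod (op z f x))\<^sup>2)"
      using FS fS by (intro sum_mono2) auto
    also have "\<dots> = (\<Sum>b\<in>B. \<Sum>k<fst b. (cmod (\<Sum>j<fst b. snd b z k j * coord f b j))\<^sup>2)"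
      unfolding split using B(2) by (intro sum.cong refl) (auto simp: op_code[OF f])
    also have "\<dots> \<le> (\<Sum>b\<in>B. t\<^sup>2 * (\<Sum>j<fst b. (cmod (coord f b j))\<^sup>2))"
      using B(2) by (intro sum_mono bound) auto
    also have "\<dots> = t\<^sup>2 * (\<Sum>x\<in>code ` S. (cmod (f x))\<^sup>2)"
      unfolding split by (simp add: coord_def sum_distrib_left)
    also have "\<dots> \<le> t\<^sup>2 * (l2_norm I f)\<^sup>2"
      unfolding l2_norm_sq using fS SI by (intro mult_left_mono finite_sum_le_infsum l2_summable f) auto
    finally show ?thesis by (simp add: power_mult_distrib)
  qed
  show ?thesis
  proof (rule that[of t], intro ballI conjI)
    fix f assume f: "f \<in> l2 I"
    have summ: "(\<lambda>x. (cmod (op z f x))\<^sup>2) summable_on I"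
      using partial[OF f] by (intro nonneg_bdd_above_summable_on bdd_aboveI2[where M = "(t * l2_norm I f)\<^sup>2"]) auto
    then show "op z f \<in> l2 I" by (simp add: l2_def op_def)
    have "(l2_norm I (op z f))\<^sup>2 \<le> (t * l2_norm I f)\<^sup>2"
      unfolding l2_norm_sq[of I "op z f"] by (intro infsum_le_finite_sums[OF summ] partial[OF f])
    then show "l2_norm I (op z f) \<le> t * l2_norm I f"
      by (rule power2_le_imp_le) (use t in \<open>simp add: l2_norm_nonneg\<close>)
  qed
qed

lemma op_l2: "f \<in> l2 I \<Longrightarrow> op z f \<in> l2 I"
  by (rule op_bounded[of z]) simp

lemma op_bops: "op z \<in> bops I"
proof -
  obtain t where "\<forall>f\<in>l2 I. op z f \<in> l2 I \<and> l2_norm I (op z f) \<le> t * l2_norm I f"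
    by (rule op_bounded)
  then show ?thesis
    by (auto simp: bops_def op_outside op_lincomb)
qed

section \<open>Inner products and accretivity in the direct sum\<close>

lemma inner_op:
  assumes "f \<in> l2 I" "g \<in> l2 I"
  shows "(\<lambda>b. sform (fst b) (snd b z) (coord f b) (coord g b)) summable_on blocks"
    and "l2_inner I (op z f) g = infsum (\<lambda>b. sform (fst b) (snd b z) (coord f b) (coord g b)) blocks"
proof -
  define h where "h x = op z f x * cnj (g x)" for x
  have inj: "inj_on code S" for S by (rule inj_on_subset[OF inj_code subset_UNIV])
  have "h summable_on I"
    unfolding h_def by (intro l2_mult_summable op_l2 assms)
  then have summ: "(h \<circ> code) summable_on Sigma blocks (\<lambda>b. {..<fst b})"
    unfolding I_def by (subst (asm) summable_on_reindex[OF inj])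
  have block: "infsum (\<lambda>k. (h \<circ> code) (b, k)) {..<fst b} = sform (fst b) (snd b z) (coord f b) (coord g b)"
    if "b \<in> blocks" for b
    using that assms by (simp add: h_def op_code sform_def coord_def sum_distrib_right)
  have summ': "(\<lambda>(b, k). (h \<circ> code) (b, k)) summable_on Sigma blocks (\<lambda>b. {..<fst b})"
    using summ by (simp add: case_prod_unfold o_def)
  from summable_on_Sigma_banach[OF summ']
  show "(\<lambda>b. sform (fst b) (snd b z) (coord f b) (coord g b)) summable_on blocks"
    by (rule summable_on_cong[THEN iffD1, rotated]) (rule block)
  have "l2_inner I (op z f) g = infsum (h \<circ> code) (Sigma blocks (\<lambda>b. {..<fst b}))"
    unfolding l2_inner_def I_def h_def[symmetric] by (subst infsum_reindex[OF inj]) simp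
  also have "\<dots> = infsum (\<lambda>b. infsum (\<lambda>k. (h \<circ> code) (b, k)) {..<fst b}) blocks"
    by (rule infsum_Sigma_banach[OF summ, symmetric])
  also have "\<dots> = infsum (\<lambda>b. sform (fst b) (snd b z) (coord f b) (coord g b)) blocks"
    by (intro infsum_cong block)
  finally show "l2_inner I (op z f) g = infsum (\<lambda>b. sform (fst b) (snd b z) (coord f b) (coord g b)) blocks" .
qed

lemma opmat_apply_vecs:
  "\<xi> \<in> vecs I n \<Longrightarrow> opmat_apply n (entrywise op A) \<xi> i \<in> l2 I"
  unfolding opmat_apply_def entrywise_def vecs_def by (intro l2_sum op_l2) auto

lemma inner_opmat_apply:
  assumes "\<xi> \<in> vecs I n" "g \<in> l2 I"
  shows "l2_inner I (opmat_apply n (entrywise op A) \<xi> p) g = (\<Sum>q<n. l2_inner I (op (A p q) (\<xi> q)) g)"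
  using assms unfolding opmat_apply_def entrywise_def
  by (intro l2_inner_sum) (auto simp: vecs_def op_l2)

lemma vec_inner_opmat:
  assumes "\<xi> \<in> vecs I n"
  shows "vec_inner I n (opmat_apply n (entrywise op A) \<xi>) \<xi>
    = (\<Sum>p<n. \<Sum>q<n. l2_inner I (op (A p q) (\<xi> q)) (\<xi> p))"
  using assms unfolding vec_inner_def
  by (intro sum.cong refl inner_opmat_apply) (auto simp: vecs_def)

lemma vec_inner_commute: "vec_inner J n \<eta> \<xi> = cnj (vec_inner J n \<xi> \<eta>)"
  by (simp add: vec_inner_def) (intro sum.cong refl l2_inner_commute)

lemma opmat_accretive_iff:
  "opmat_accretive I n (entrywise op A)
    \<longleftrightarrow> (\<forall>\<xi>\<in>vecs I n. 0 \<le> Re (\<Sum>p<n. \<Sum>q<n. l2_inner I (op (A p q) (\<xi> q)) (\<xi> p)))"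
proof -
  have "(vec_inner I n (opmat_apply n (entrywise op A) \<xi>) \<xi> + vec_inner I n \<xi> (opmat_apply n (entrywise op A) \<xi>)) / 2
      = of_real (Re (\<Sum>p<n. \<Sum>q<n. l2_inner I (op (A p q) (\<xi> q)) (\<xi> p)))" if "\<xi> \<in> vecs I n" for \<xi>
    unfolding vec_inner_commute[of I n \<xi>] vec_inner_opmat[OF that] complex_add_cnj by simp
  then show ?thesis
    unfolding opmat_accretive_def Let_def
    by (intro ball_cong refl) (simp only: Im_complex_of_real Re_complex_of_real simp_thms)
qed

lemma opmat_form:
  assumes "\<xi> \<in> vecs I n"
  shows "(\<lambda>b. form (snd b) (fst b) n A (\<lambda>p. coord (\<xi> p) b)) summable_on blocks"
    and "(\<Sum>p<n. \<Sum>q<n. l2_inner I (op (A p q) (\<xi> q)) (\<xi> p))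
      = infsum (\<lambda>b. form (snd b) (fst b) n A (\<lambda>p. coord (\<xi> p) b)) blocks"
proof -
  have \<xi>: "p < n \<Longrightarrow> \<xi> p \<in> l2 I" for p using assms by (simp add: vecs_def)
  define s where "s p q b = sform (fst b) (snd b (A p q)) (coord (\<xi> q) b) (coord (\<xi> p) b)" for p q b
  have summ: "s p q summable_on blocks" if "p < n" "q < n" for p q
    unfolding s_def using inner_op(1)[OF \<xi> \<xi>] that by blast
  have row: "(\<lambda>b. \<Sum>q<n. s p q b) summable_on blocks \<and> infsum (\<lambda>b. \<Sum>q<n. s p q b) blocks = (\<Sum>q<n. infsum (s p q) blocks)"
    if "p < n" for p
    using that by (intro infsum_sum_finite summ) auto
  have all: "(\<lambda>b. \<Sum>p<n. \<Sum>q<n. s p q b) summable_on blocks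
      \<and> infsum (\<lambda>b. \<Sum>p<n. \<Sum>q<n. s p q b) blocks = (\<Sum>p<n. infsum (\<lambda>b. \<Sum>q<n. s p q b) blocks)"
    using row by (intro infsum_sum_finite) auto
  then show "(\<lambda>b. form (snd b) (fst b) n A (\<lambda>p. coord (\<xi> p) b)) summable_on blocks"
    by (simp add: form_def s_def)
  have "(\<Sum>p<n. \<Sum>q<n. l2_inner I (op (A p q) (\<xi> q)) (\<xi> p)) = (\<Sum>p<n. \<Sum>q<n. infsum (s p q) blocks)"
    unfolding s_def by (intro sum.cong refl inner_op(2) \<xi>) auto
  also have "\<dots> = (\<Sum>p<n. infsum (\<lambda>b. \<Sum>q<n. s p q b) blocks)"
    using row by (intro sum.cong) auto
  finally show "(\<Sum>p<n. \<Sum>q<n. l2_inner I (op (A p q) (\<xi> q)) (\<xi> p))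
      = infsum (\<lambda>b. form (snd b) (fst b) n A (\<lambda>p. coord (\<xi> p) b)) blocks"
    using all by (simp add: form_def s_def)
qed

lemma opmat_accretive_if_C:
  assumes "1 \<le> n" "A \<in> C n"
  shows "opmat_accretive I n (entrywise op A)"
  unfolding opmat_accretive_iff
proof
  fix \<xi> assume \<xi>: "\<xi> \<in> vecs I n"
  have "0 \<le> infsum (\<lambda>b. Re (form (snd b) (fst b) n A (\<lambda>p. coord (\<xi> p) b))) blocks"
    using assms by (intro infsum_nonneg real_cp_form blocks_cp)
  then show "0 \<le> Re (\<Sum>p<n. \<Sum>q<n. l2_inner I (op (A p q) (\<xi> q)) (\<xi> p))"
    by (simp only: opmat_form[OF \<xi>] infsum_Re)
qed

lemma C_if_opmat_accretive:
  assumes n: "1 \<le> n" and A: "A \<in> mats n" and acc: "opmat_accretive I n (entrywise op A)"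
  shows "A \<in> C n"
proof (rule ccontr)
  assume "A \<notin> C n"
  then obtain \<phi> \<eta> where \<phi>: "real_cp n \<phi>" "unital n \<phi>" "Re (form \<phi> n n A \<eta>) < 0"
    by (rule unital_separation[OF n A])
  define b where "b = (n, \<phi>)"
  have b: "b \<in> blocks" using \<phi> n by (simp add: b_def blocks_def)
  \<comment> \<open>The separating tuple \<open>\<eta>\<close> placed in the block \<open>b\<close>
    and extended by 0. The other blocks then contribute nothing, and the infinite sum is the single
    negative term.\<close>
  define \<xi> where "\<xi> p x = (if x \<in> code ` ({b} \<times> {..<n}) then \<eta> p (snd (inv code x)) else 0)" for p x
  have "\<xi> p \<in> l2 I" for p
  proof -
    have "(\<lambda>x. (cmod (\<xi> p x))\<^sup>2) summable_on I"
    proof (rule finite_nonzero_values_imp_summable_on, rule finite_subset)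
      show "{x \<in> I. (cmod (\<xi> p x))\<^sup>2 \<noteq> 0} \<subseteq> code ` ({b} \<times> {..<n})" by (auto simp: \<xi>_def)
    qed simp
    moreover have "code ` ({b} \<times> {..<n}) \<subseteq> I" using b by (auto simp: I_def b_def)
    ultimately show ?thesis by (auto simp: l2_def \<xi>_def)
  qed
  then have \<xi>: "\<xi> \<in> vecs I n" by (simp add: vecs_def)
  have coord_b: "j < n \<Longrightarrow> coord (\<xi> p) b j = \<eta> p j" for p j
    by (simp add: coord_def \<xi>_def inv_f_f[OF inj_code])
  have coord_0: "coord (\<xi> p) b' j = 0" if "b' \<noteq> b" for p b' j
    using that by (auto simp: coord_def \<xi>_def inj_eq[OF inj_code])
  have "(\<Sum>p<n. \<Sum>q<n. l2_inner I (op (A p q) (\<xi> q)) (\<xi> p))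
      = infsum (\<lambda>b. form (snd b) (fst b) n A (\<lambda>p. coord (\<xi> p) b)) blocks"
    by (rule opmat_form(2)[OF \<xi>])
  also have "\<dots> = infsum (\<lambda>b. form (snd b) (fst b) n A (\<lambda>p. coord (\<xi> p) b)) {b}"
    using b by (intro infsum_cong_neutral) (auto simp: form_def sform_def coord_0)
  also have "\<dots> = form \<phi> n n A (\<lambda>p. coord (\<xi> p) b)" by (simp add: b_def)
  also have "\<dots> = form \<phi> n n A \<eta>" by (rule form_cong) (simp add: coord_b)
  finally have "Re (\<Sum>p<n. \<Sum>q<n. l2_inner I (op (A p q) (\<xi> q)) (\<xi> p)) < 0"
    using \<phi>(3) by (simp only:)
  moreover have "0 \<le> Re (\<Sum>p<n. \<Sum>q<n. l2_inner I (op (A p q) (\<xi> q)) (\<xi> p))"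
    using acc \<xi> unfolding opmat_accretive_iff by (rule bspec)
  ultimately show False by linarith
qed

end

subsection \<open>The matrix norms\<close>

context direct_sum
begin

lemma vec_norm_nonneg: "0 \<le> vec_norm I n \<xi>"
  by (simp add: vec_norm_def sum_nonneg)

lemma vec_norm_sq: "(vec_norm I n \<xi>)\<^sup>2 = (\<Sum>i<n. (l2_norm I (\<xi> i))\<^sup>2)"
  by (simp add: vec_norm_def sum_nonneg)

lemma vec_norm_scale: "vec_norm I n (\<lambda>i x. c * \<xi> i x) = cmod c * vec_norm I n \<xi>"
  by (simp add: vec_norm_def l2_norm_scale power_mult_distrib real_sqrt_mult flip: sum_distrib_left)

lemma opmat_apply_scale:
  assumes "\<xi> \<in> vecs I n"
  shows "opmat_apply n (entrywise op A) (\<lambda>i x. c * \<xi> i x) = (\<lambda>i x. c * opmat_apply n (entrywise op A) \<xi> i x)"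
proof -
  have "op z (\<lambda>x. c * \<xi> j x) = (\<lambda>x. c * op z (\<xi> j) x)" if "j < n" for z j
    using op_lincomb[of "\<xi> j" "\<lambda>_. 0" z c 0] assms that by (simp add: vecs_def l2_zero)
  then show ?thesis
    by (simp add: opmat_apply_def entrywise_def sum_distrib_left fun_eq_iff)
qed

lemma form_scaled_unit_minus_corner2:
  assumes \<zeta>: "\<zeta> \<in> vecs I (2 * n)"
  shows "Re (\<Sum>p<2*n. \<Sum>q<2*n. l2_inner I
        (op ((mscale sc (complex_of_real t) (diagI e (2 * n)) - corner2 n z) p q) (\<zeta> q)) (\<zeta> p))
    = t * ((vec_norm I n \<zeta>)\<^sup>2 + (vec_norm I n (\<lambda>i. \<zeta> (n + i)))\<^sup>2)
      - 2 * (\<Sum>p<n. Re (l2_inner I (opmat_apply n (entrywise op z) (\<lambda>i. \<zeta> (n + i)) p) (\<zeta> p)))"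
proof -
  \<comment> \<open>Cutting off beyond \<open>2 * n\<close> makes every component square-summable,
    as the abstract identity asks for linearity at all index pairs.\<close>
  define \<eta> where "\<eta> p = (if p < 2 * n then \<zeta> p else (\<lambda>_. 0))" for p
  have \<eta>: "\<eta> p \<in> l2 I" for p
    using \<zeta> by (simp add: \<eta>_def vecs_def l2_zero)
  have self: "l2_inner I (op e (\<eta> p)) (\<eta> p) = of_real ((l2_norm I (\<eta> p))\<^sup>2)" for p
    by (simp only: op_unit idop_def \<eta> if_True l2_inner_self)
  have "(\<Sum>p<2*n. \<Sum>q<2*n. l2_inner I
        (op ((mscale sc (complex_of_real t) (diagI e (2 * n)) - corner2 n z) p q) (\<zeta> q)) (\<zeta> p))
    = (\<Sum>p<2*n. \<Sum>q<2*n. l2_inner I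
        (op ((mscale sc (complex_of_real t) (diagI e (2 * n)) - corner2 n z) p q) (\<eta> q)) (\<eta> p))"
    by (intro sum.cong refl) (simp add: \<eta>_def)
  also have "\<dots> = of_real t * (\<Sum>p<2*n. l2_inner I (op e (\<eta> p)) (\<eta> p))
      - 2 * (\<Sum>p<n. \<Sum>q<n. l2_inner I (op (z p q) (\<eta> (n + q))) (\<eta> p))"
    by (rule sum_scaled_unit_minus_corner2)
      (simp_all add: op_add op_scale l2_inner_add l2_inner_scale op_l2 \<eta>)
  also have "(\<Sum>p<2*n. l2_inner I (op e (\<eta> p)) (\<eta> p))
      = of_real ((vec_norm I n \<zeta>)\<^sup>2 + (vec_norm I n (\<lambda>i. \<zeta> (n + i)))\<^sup>2)"
    unfolding self vec_norm_sq mult_2 sum_lessThan_add by (simp add: \<eta>_def)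
  also have "(\<Sum>p<n. \<Sum>q<n. l2_inner I (op (z p q) (\<eta> (n + q))) (\<eta> p))
      = (\<Sum>p<n. l2_inner I (opmat_apply n (entrywise op z) (\<lambda>i. \<zeta> (n + i)) p) (\<zeta> p))"
    using \<zeta> by (intro sum.cong refl) (simp add: \<eta>_def inner_opmat_apply vecs_def)
  finally show ?thesis by (simp only: minus_complex.sel Re_complex_of_real Re_sum flip: of_real_mult) simp
qed

text \<open>At a pair \<open>(u, \<xi>)\<close> the real part of the form is \<open>t\<close> times
  the sum of the squared norms minus twice the real part of the inner product of
  \<open>T \<xi>\<close> with \<open>u\<close>. The doubled corner is what makes the threshold
  exactly \<open>t\<close>; with \<open>z\<close> in place of \<open>2 z\<close> it would be
  \<open>2 t\<close>.\<close>

lemma corner2_C_iff: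
  assumes n: "1 \<le> n" and t: "t > 0"
  shows "mscale sc (complex_of_real t) (diagI e (2 * n)) - corner2 n z \<in> C (2 * n)
    \<longleftrightarrow> (\<forall>\<xi>\<in>vecs I n. vec_norm I n (opmat_apply n (entrywise op z) \<xi>) \<le> t * vec_norm I n \<xi>)"
    (is "?A \<in> _ \<longleftrightarrow> _")
proof -
  let ?N = "vec_norm I n" and ?T = "opmat_apply n (entrywise op z)"
  have "?A \<in> mats (2 * n)"
    by (auto simp: mats_def mscale_def diagI_def corner2_def)
  then have "?A \<in> C (2 * n) \<longleftrightarrow> opmat_accretive I (2 * n) (entrywise op ?A)"
    using n opmat_accretive_if_C[of "2 * n" ?A] C_if_opmat_accretive[of "2 * n" ?A] by auto
  also have "\<dots> \<longleftrightarrow> (\<forall>\<xi>\<in>vecs I n. ?N (?T \<xi>) \<le> t * ?N \<xi>)"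
    unfolding opmat_accretive_iff
  proof (intro iffI ballI)
    fix \<xi> assume pos: "\<forall>\<zeta>\<in>vecs I (2 * n). 0 \<le> Re (\<Sum>p<2*n. \<Sum>q<2*n. l2_inner I (op (?A p q) (\<zeta> q)) (\<zeta> p))"
      and \<xi>: "\<xi> \<in> vecs I n"
    \<comment> \<open>The minimising first component \<open>u = T \<xi> / t\<close>, as in
      \<open>block_bound\<close>.\<close>
    define \<zeta> where "\<zeta> p = (if p < n then (\<lambda>x. complex_of_real (1 / t) * ?T \<xi> p x) else \<xi> (p - n))" for p
    have \<zeta>: "\<zeta> \<in> vecs I (2 * n)"
    proof -
      have "\<zeta> p \<in> l2 I" if "p < 2 * n" for p
      proof (cases "p < n")
        case True
        show ?thesis
          unfolding \<zeta>_def if_P[OF True] by (rule l2_scale[OF opmat_apply_vecs[OF \<xi>]])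
      next
        case False
        with that \<xi> show ?thesis by (simp add: \<zeta>_def vecs_def)
      qed
      then show ?thesis by (simp add: vecs_def)
    qed
    have upper: "(\<lambda>i. \<zeta> (n + i)) = \<xi>" by (simp add: \<zeta>_def)
    have "?N \<zeta> = ?N (\<lambda>p x. complex_of_real (1 / t) * ?T \<xi> p x)"
      by (simp add: vec_norm_def \<zeta>_def)
    then have lower: "(?N \<zeta>)\<^sup>2 = (?N (?T \<xi>))\<^sup>2 / t\<^sup>2"
      using t by (simp only: vec_norm_scale) (simp add: norm_divide power_divide)
    have "(\<Sum>p<n. Re (l2_inner I (?T \<xi> p) (\<zeta> p))) = (?N (?T \<xi>))\<^sup>2 / t"
    proof -
      have "Re (l2_inner I (?T \<xi> p) (\<zeta> p)) = (l2_norm I (?T \<xi> p))\<^sup>2 / t" if "p < n" for p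
      proof -
        have "l2_inner I (?T \<xi> p) (\<zeta> p) = cnj (of_real (1 / t) * l2_inner I (?T \<xi> p) (?T \<xi> p))"
          using that by (subst l2_inner_commute) (simp only: \<zeta>_def if_True l2_inner_scale)
        then show ?thesis by (simp add: l2_inner_self[OF opmat_apply_vecs[OF \<xi>]] flip: of_real_power)
      qed
      then show ?thesis by (simp add: vec_norm_sq sum_divide_distrib)
    qed
    with form_scaled_unit_minus_corner2[OF \<zeta>, of t z] bspec[OF pos \<zeta>]
    have "0 \<le> t * ((?N (?T \<xi>))\<^sup>2 / t\<^sup>2 + (?N \<xi>)\<^sup>2) - 2 * ((?N (?T \<xi>))\<^sup>2 / t)"
      by (simp only: upper lower)
    also have "\<dots> = ((t * ?N \<xi>)\<^sup>2 - (?N (?T \<xi>))\<^sup>2) / t"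
      using t by (simp add: field_simps power2_eq_square)
    finally have "(?N (?T \<xi>))\<^sup>2 \<le> (t * ?N \<xi>)\<^sup>2"
      using t by (simp add: zero_le_divide_iff)
    then show "?N (?T \<xi>) \<le> t * ?N \<xi>"
      by (rule power2_le_imp_le) (use t in \<open>simp add: vec_norm_nonneg\<close>)
  next
    fix \<zeta> assume le: "\<forall>\<xi>\<in>vecs I n. ?N (?T \<xi>) \<le> t * ?N \<xi>" and \<zeta>: "\<zeta> \<in> vecs I (2 * n)"
    let ?\<xi> = "\<lambda>i. \<zeta> (n + i)"
    have \<xi>: "?\<xi> \<in> vecs I n" and \<zeta>n: "\<And>p. p < n \<Longrightarrow> \<zeta> p \<in> l2 I"
      using \<zeta> by (auto simp: vecs_def)
    have "2 * (\<Sum>p<n. Re (l2_inner I (?T ?\<xi> p) (\<zeta> p)))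
        \<le> (\<Sum>p<n. (l2_norm I (?T ?\<xi> p))\<^sup>2 / t + t * (l2_norm I (\<zeta> p))\<^sup>2)"
      unfolding sum_distrib_left
      by (intro sum_mono l2_inner_young opmat_apply_vecs[OF \<xi>] \<zeta>n t) auto
    also have "\<dots> = (?N (?T ?\<xi>))\<^sup>2 / t + t * (?N \<zeta>)\<^sup>2"
      by (simp add: vec_norm_sq sum.distrib sum_divide_distrib sum_distrib_left)
    also have "\<dots> \<le> (t * ?N ?\<xi>)\<^sup>2 / t + t * (?N \<zeta>)\<^sup>2"
      using bspec[OF le \<xi>] t
      by (intro add_right_mono divide_right_mono power_mono vec_norm_nonneg) auto
    also have "\<dots> = t * ((?N \<zeta>)\<^sup>2 + (?N ?\<xi>)\<^sup>2)"
      using t by (simp add: field_simps power2_eq_square)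
    finally show "0 \<le> Re (\<Sum>p<2*n. \<Sum>q<2*n. l2_inner I (op (?A p q) (\<zeta> q)) (\<zeta> p))"
      unfolding form_scaled_unit_minus_corner2[OF \<zeta>] by linarith
  qed
  finally show ?thesis .
qed

lemma opmat_norm_eq_mou_norm:
  assumes n: "1 \<le> n"
  shows "opmat_norm I n (entrywise op z) = mou_norm sc C e n z"
proof -
  let ?N = "vec_norm I n" and ?T = "opmat_apply n (entrywise op z)"
  define S where "S = (\<lambda>\<xi>. ?N (?T \<xi>)) ` {\<xi>. \<xi> \<in> vecs I n \<and> ?N \<xi> \<le> 1}"
  define U where "U = {t::real. t > 0 \<and> (\<forall>\<xi>\<in>vecs I n. ?N (?T \<xi>) \<le> t * ?N \<xi>)}"
  have mou: "mou_norm sc C e n z = Inf U"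
    unfolding mou_norm_def U_def using corner2_C_iff[OF n]
    by (intro arg_cong[where f = Inf] Collect_cong conj_cong refl)
  obtain t0 where "t0 > 0" "mscale sc (complex_of_real t0) (diagI e (2 * n)) - corner2 n z \<in> C (2 * n)"
    by (rule corner2_unit[OF n])
  then have t0: "t0 \<in> U" using corner2_C_iff[OF n] by (simp add: U_def)
  have upper: "s \<le> t" if "s \<in> S" "t \<in> U" for s t
  proof -
    from that(1) obtain \<xi> where \<xi>: "s = ?N (?T \<xi>)" "\<xi> \<in> vecs I n" "?N \<xi> \<le> 1"
      by (auto simp: S_def)
    with that(2) have "s \<le> t * ?N \<xi>" by (simp add: U_def)
    also have "\<dots> \<le> t" using that(2) \<xi>(3) by (simp add: U_def mult_left_le)
    finally show ?thesis .
  qed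
  have bdd: "bdd_above S" using upper[OF _ t0] by (rule bdd_aboveI)
  have zero: "(\<lambda>_ _. 0) \<in> vecs I n" by (simp add: vecs_def l2_zero)
  have "?N (\<lambda>_ _. 0) \<le> 1" by (simp add: vec_norm_def l2_norm_def)
  with zero have ne: "?N (?T (\<lambda>_ _. 0)) \<in> S" unfolding S_def by (intro imageI CollectI conjI)
  have S_nonneg: "0 \<le> Sup S"
    using cSup_upper[OF ne bdd] vec_norm_nonneg[of n "?T (\<lambda>_ _. 0)"] by linarith
  \<comment> \<open>Strictness matters: members of \<open>U\<close> are positive, so
    \<open>Sup S\<close> itself is not one when the operator is 0. The infimum is therefore
    approached from above.\<close>
  have in_U: "t \<in> U" if t: "Sup S < t" for t
    unfolding U_def
  proof (intro CollectI conjI ballI)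
    show "0 < t" using t S_nonneg by simp
    fix \<xi> assume \<xi>: "\<xi> \<in> vecs I n"
    show "?N (?T \<xi>) \<le> t * ?N \<xi>"
    proof (cases "?N \<xi> = 0")
      \<comment> \<open>Such a \<open>\<xi>\<close> cannot be normalised, but the bound by
        \<open>t0\<close> already forces its image to have norm 0.\<close>
      case True
      then show ?thesis using t0 \<xi> by (auto simp: U_def)
    next
      case False
      then have pos: "?N \<xi> > 0" using vec_norm_nonneg[of n \<xi>] by simp
      define c where "c = complex_of_real (1 / ?N \<xi>)"
      have c: "cmod c = 1 / ?N \<xi>" using pos by (simp add: c_def norm_divide)
      have "(\<lambda>i x. c * \<xi> i x) \<in> vecs I n" using \<xi> by (simp add: vecs_def l2_scale)
      moreover have "?N (\<lambda>i x. c * \<xi> i x) \<le> 1" using pos by (simp add: vec_norm_scale c)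
      ultimately have "?N (?T (\<lambda>i x. c * \<xi> i x)) \<in> S" unfolding S_def by (intro imageI CollectI conjI)
      then have "?N (?T (\<lambda>i x. c * \<xi> i x)) \<le> t" using cSup_upper[OF _ bdd, of "?N (?T (\<lambda>i x. c * \<xi> i x))"] t by linarith
      then have "?N (?T \<xi>) / ?N \<xi> \<le> t" by (simp add: opmat_apply_scale[OF \<xi>] vec_norm_scale c)
      then show ?thesis using pos by (simp add: divide_le_eq)
    qed
  qed
  have "Sup S = Inf U"
  proof (rule antisym)
    have ne': "S \<noteq> {}" "U \<noteq> {}" using ne t0 by blast+
    have "Sup S \<le> t" if "t \<in> U" for t
      using upper[OF _ that] by (rule cSup_least[OF ne'(1)])
    then show "Sup S \<le> Inf U" by (rule cInf_greatest[OF ne'(2)])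
    have below: "bdd_below U" unfolding U_def by (rule bdd_belowI[of _ 0]) simp
    show "Inf U \<le> Sup S"
    proof (rule dense_ge)
      fix t assume "Sup S < t"
      then show "Inf U \<le> t" by (rule cInf_lower[OF in_U below])
    qed
  qed
  then show ?thesis by (simp only: opmat_norm_def S_def mou setcompr_eq_image)
qed

text \<open>Every complex multiple of an element of the kernel is mapped to 0, which is accretive,
  so all these multiples lie in \<open>C 1\<close>. Properness then leaves only 0.\<close>

lemma inj_op: "inj op"
proof (rule injI)
  fix z w assume "op z = op w"
  then have "op (z - w) = (\<lambda>f x. 0)"
    using op_add[of "z - w" w] by (simp add: fun_eq_iff)
  then have zero: "op (sc c (z - w)) f = (\<lambda>x. 0)" for c f
    by (simp add: op_scale)
  have in_C: "mscale sc c (sgl (z - w)) \<in> C 1" for c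
  proof (rule C_if_opmat_accretive)
    show "mscale sc c (sgl (z - w)) \<in> mats 1"
      by (auto simp: mats_def mscale_def sgl_def)
    show "opmat_accretive I 1 (entrywise op (mscale sc c (sgl (z - w))))"
      unfolding opmat_accretive_iff by (simp add: mscale_def sgl_def zero l2_inner_def)
  qed simp
  have cancel: "sgl (z - w) \<in> mscale sc c ` C 1" if "c * d = 1" for c d
    using in_C[of d] that by (intro image_eqI[of _ _ "mscale sc d (sgl (z - w))"]) (simp_all add: mscale_mscale, simp add: mscale_def)
  have "sgl (z - w) \<in> C 1 \<inter> mscale sc (-1) ` C 1 \<inter> mscale sc \<i> ` C 1 \<inter> mscale sc (-\<i>) ` C 1"
    using cancel[of "-1" "-1"] cancel[of \<i> "-\<i>"] cancel[of "-\<i>" \<i>] in_C[of 1]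
    by (simp add: mscale_def)
  moreover have "C 1 \<inter> mscale sc (-1) ` C 1 \<inter> mscale sc \<i> ` C 1 \<inter> mscale sc (-\<i>) ` C 1 = {0}"
    using aamou by (simp only: aamou_space_def accretive_mos_def C_proper_def)
  ultimately have "sgl (z - w) \<in> {0}" by (simp only:)
  then have "sgl (z - w) 0 0 = 0" by simp
  then show "z = w" by (simp add: sgl_def)
qed

lemma op_embedding: "real_complete_order_embedding sc C I op"
  unfolding real_complete_order_embedding_def
  using op_bops op_add op_scale inj_op opmat_accretive_if_C C_if_opmat_accretive
  by (auto simp: fun_eq_iff)

end

subsection \<open>Size of the index set\<close>

text \<open>Real and imaginary parts are turned into sets of naturals. The whole sequence becomes a
  set of triples (part, index, element) over a countable type, hence again a set of naturals, hence
  a real number.\<close>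

lemma ex_inj_sequences: "\<exists>f :: (nat \<Rightarrow> complex) \<Rightarrow> complex. inj f"
proof -
  obtain r :: "nat set \<Rightarrow> real" where r: "inj r"
    using nat_sets_eqpoll_reals unfolding eqpoll_def bij_betw_def by blast
  obtain s :: "real \<Rightarrow> nat set" where s: "inj s"
    using eqpoll_sym[OF nat_sets_eqpoll_reals] unfolding eqpoll_def bij_betw_def by blast
  define E where "E u = {(b, i, k). k \<in> s (if b then Re (u i) else Im (u i))}"
    for u :: "nat \<Rightarrow> complex"
  have "inj (\<lambda>u. complex_of_real (r (to_nat ` E u)))"
  proof (rule injI)
    fix u v assume "complex_of_real (r (to_nat ` E u)) = complex_of_real (r (to_nat ` E v))"
    then have "to_nat ` E u = to_nat ` E v"
      using r by (simp add: inj_eq)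
    then have "E u = E v" by (simp add: inj_image_eq_iff)
    then have "k \<in> s (if b then Re (u i) else Im (u i)) \<longleftrightarrow> k \<in> s (if b then Re (v i) else Im (v i))" for b i k
      by (auto simp: E_def set_eq_iff)
    then have "s (if b then Re (u i) else Im (u i)) = s (if b then Re (v i) else Im (v i))" for b i
      by blast
    then have "(if b then Re (u i) else Im (u i)) = (if b then Re (v i) else Im (v i))" for b i
      using s by (simp only: inj_eq)
    from this[of True] this[of False] show "u = v" by (simp add: complex_eq_iff fun_eq_iff)
  qed
  then show ?thesis by blast
qed

text \<open>The code is built pointwise in \<open>z\<close>: the size, the coordinate and the matrix
  at \<open>z\<close> are packed into one sequence and then into one complex number. The two
  naturals are repeated at every \<open>z\<close>.\<close>

lemma ex_inj_code:
  "\<exists>code :: (nat \<times> ('z \<Rightarrow> nat \<Rightarrow> nat \<Rightarrow> complex)) \<times> nat \<Rightarrow> 'z \<Rightarrow> complex. inj code"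
proof -
  obtain f :: "(nat \<Rightarrow> complex) \<Rightarrow> complex" where f: "inj f"
    using ex_inj_sequences by (rule exE)
  \<comment> \<open>Positions 0 and 1 hold the naturals; the matrix entries follow through the
    pairing function, shifted by 2.\<close>
  define u where "u n i M l = (if l = 0 then of_nat n else if l = 1 then of_nat i
      else case prod_decode (l - 2) of (p, q) \<Rightarrow> M p q)" for n i :: nat and M :: "nat \<Rightarrow> nat \<Rightarrow> complex" and l
  have u: "n = n' \<and> i = i' \<and> M = M'" if "u n i M = u n' i' M'" for n n' i i' M M'
  proof -
    have "u n i M l = u n' i' M' l" for l by (simp add: that)
    from this[of 0] this[of 1] this[of "prod_encode (p, q) + 2" for p q] show ?thesis
      by (simp add: u_def fun_eq_iff)
  qed
  have "inj (\<lambda>x (z :: 'z). f (u (fst (fst x)) (snd x) (snd (fst x) z)))"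
  proof (rule injI)
    fix x y :: "(nat \<times> ('z \<Rightarrow> nat \<Rightarrow> nat \<Rightarrow> complex)) \<times> nat"
    assume "(\<lambda>z. f (u (fst (fst x)) (snd x) (snd (fst x) z))) = (\<lambda>z. f (u (fst (fst y)) (snd y) (snd (fst y) z)))"
    then have "f (u (fst (fst x)) (snd x) (snd (fst x) z)) = f (u (fst (fst y)) (snd y) (snd (fst y) z))" for z
      by (rule fun_cong)
    then have "u (fst (fst x)) (snd x) (snd (fst x) z) = u (fst (fst y)) (snd y) (snd (fst y) z)" for z
      using f by (simp only: inj_eq)
    then have "fst (fst x) = fst (fst y) \<and> snd x = snd y \<and> snd (fst x) z = snd (fst y) z" for z
      by (rule u)
    then show "x = y" by (simp add: prod_eq_iff fun_eq_iff)
  qed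
  then show ?thesis by (rule exI[where P = inj])
qed

theorem theorem3p4:
  fixes sc :: "complex \<Rightarrow> 'z::ab_group_add \<Rightarrow> 'z"
    and C :: "nat \<Rightarrow> (nat \<Rightarrow> nat \<Rightarrow> 'z) set"
    and e :: 'z
  assumes "aamou_space sc C e"
  shows "\<exists>(I :: ('z \<Rightarrow> complex) set) phi.
           real_complete_order_embedding sc C I phi
         \<and> phi e = idop I
         \<and> (\<forall>n\<ge>1. \<forall>z\<in>mats n. opmat_norm I n (entrywise phi z) = mou_norm sc C e n z)"
proof -
  obtain code :: "(nat \<times> ('z \<Rightarrow> nat \<Rightarrow> nat \<Rightarrow> complex)) \<times> nat \<Rightarrow> 'z \<Rightarrow> complex" where "inj code"
    using ex_inj_code by (rule exE)
  with assms interpret direct_sum sc C e code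
    by unfold_locales
  show ?thesis
    by (intro exI[of _ I] exI[of _ op] conjI allI impI ballI op_embedding op_unit opmat_norm_eq_mou_norm)
qed

end
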